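(* Let $k\in\mathbb{Z}^+$ and let $\mu$ be a non-negative finite Borel measure on $\mathbb{H}_k$. The following are equivalent: (i) $\mu$ is a Carleson measure of $A^2(\mathbb{H}_k)$; (ii) $\mathcal{B}_\mu\in L^\infty(\mathbb{H}_k)$; (iii) $T_\mu\in L^\infty(\mathbb{H}_k)$.
   Context: $\mathbb{H}_k=\{(z_1,z_2)\in\mathbb{C}^2:|z_1|^k<|z_2|<1\}$. $dV$ is Lebesgue measure, $A^2(\mathbb{H}_k)$ the holomorphic $dV$-square-integrable functions. With $s=z_1\overline{w}_1$, $t=z_2\overline{w}_2$, the Bergman kernel of $\mathbb{H}_k$ is $K(z,w)=\dfrac{p_k(s)t^2+q_k(s)t+s^kp_k(s)}{k\pi^2(1-t)^2(t-s^k)^2}$, where $p_k(s)=\sum_{j=1}^{k-1}j(k-j)s^{j-1}$ ($p_1\equiv0$) and $q_k(s)=\sum_{j=1}^k\big(j^2+(k-j)^2s^k\big)s^{j-1}$. Define $\mathcal{P}(z,w)=\dfrac{t}{(1-t)^2(t-s^k)^2}$, $T_\mu(w)=\int_{\mathbb{H}_k}\frac{|\mathcal{P}(z,w)|^2}{K(w,w)}d\mu(z)$ and $\mathcal{B}_\mu(w)=\int_{\mathbb{H}_k}\frac{|K(z,w)|^2}{K(w,w)}d\mu(z)$. $\mu$ is Carleson if there is $C>0$ with $\int|h|^2d\mu\le C\int|h|^2dV$ for all $h\in A^2(\mathbb{H}_k)$. *)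

theory Defs
  imports "HOL-Analysis.Analysis"
begin

definition Hk :: "nat \<Rightarrow> (complex \<times> complex) set" where
  "Hk k = {z. cmod (fst z) ^ k < cmod (snd z) \<and> cmod (snd z) < 1}"

text \<open>Holomorphy on an open set of C^2: complex (Frechet) differentiability,
  i.e. the derivative is a complex-linear map h \<mapsto> a * h1 + b * h2.\<close>
definition holomorphic2_on :: "(complex \<times> complex \<Rightarrow> complex) \<Rightarrow> (complex \<times> complex) set \<Rightarrow> bool" where
  "holomorphic2_on f U \<longleftrightarrow>
     (\<forall>z\<in>U. \<exists>a b. (f has_derivative (\<lambda>h. a * fst h + b * snd h)) (at z))"

definition A2 :: "nat \<Rightarrow> (complex \<times> complex \<Rightarrow> complex) set" where
  "A2 k = {f. holomorphic2_on f (Hk k) \<and>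
              (\<integral>\<^sup>+ z \<in> Hk k. ennreal ((cmod (f z))\<^sup>2) \<partial>lborel) < \<infinity>}"

definition pk :: "nat \<Rightarrow> complex \<Rightarrow> complex" where
  "pk k s = (\<Sum>j = 1..k - 1. of_nat (j * (k - j)) * s ^ (j - 1))"

definition qk :: "nat \<Rightarrow> complex \<Rightarrow> complex" where
  "qk k s = (\<Sum>j = 1..k. (of_nat (j\<^sup>2) + of_nat ((k - j)\<^sup>2) * s ^ k) * s ^ (j - 1))"

definition BergK :: "nat \<Rightarrow> complex \<times> complex \<Rightarrow> complex \<times> complex \<Rightarrow> complex" where
  "BergK k z w =
    (let s = fst z * cnj (fst w); t = snd z * cnj (snd w) in
      (pk k s * t\<^sup>2 + qk k s * t + s ^ k * pk k s) /
      (of_nat k * of_real (pi\<^sup>2) * (1 - t)\<^sup>2 * (t - s ^ k)\<^sup>2))"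

definition PP :: "nat \<Rightarrow> complex \<times> complex \<Rightarrow> complex \<times> complex \<Rightarrow> complex" where
  "PP k z w =
    (let s = fst z * cnj (fst w); t = snd z * cnj (snd w) in
      t / ((1 - t)\<^sup>2 * (t - s ^ k)\<^sup>2))"

definition T_mu :: "nat \<Rightarrow> (complex \<times> complex) measure \<Rightarrow> complex \<times> complex \<Rightarrow> ennreal" where
  "T_mu k \<mu> w = (\<integral>\<^sup>+ z \<in> Hk k. ennreal ((cmod (PP k z w))\<^sup>2 / Re (BergK k w w)) \<partial>\<mu>)"

definition B_mu :: "nat \<Rightarrow> (complex \<times> complex) measure \<Rightarrow> complex \<times> complex \<Rightarrow> ennreal" where
  "B_mu k \<mu> w = (\<integral>\<^sup>+ z \<in> Hk k. ennreal ((cmod (BergK k z w))\<^sup>2 / Re (BergK k w w)) \<partial>\<mu>)"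

definition carleson :: "nat \<Rightarrow> (complex \<times> complex) measure \<Rightarrow> bool" where
  "carleson k \<mu> \<longleftrightarrow> (\<exists>C>0. \<forall>h\<in>A2 k.
     (\<integral>\<^sup>+ z \<in> Hk k. ennreal ((cmod (h z))\<^sup>2) \<partial>\<mu>)
       \<le> ennreal C * (\<integral>\<^sup>+ z \<in> Hk k. ennreal ((cmod (h z))\<^sup>2) \<partial>lborel))"

definition Linf_on :: "(complex \<times> complex) set \<Rightarrow> (complex \<times> complex \<Rightarrow> ennreal) \<Rightarrow> bool" where
  "Linf_on U f \<longleftrightarrow> f \<in> borel_measurable (restrict_space lborel U) \<and>
     (\<exists>M::real. AE w in lborel. w \<in> U \<longrightarrow> f w \<le> ennreal M)"

end

theory Submission
  imports Defs "HOL-Complex_Analysis.Complex_Analysis"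
begin

text \<open>
  The map \<open>(\<sigma>, \<omega>) \<mapsto> (\<sigma>\<omega>, \<omega>\<^sup>k)\<close> is a \<open>k\<close>-to-one covering of \<open>Hk k\<close> by the disc times the punctured disc, with
  Jacobian \<open>k\<omega>\<^sup>k\<close>. Hence \<open>h \<mapsto> \<omega>\<^sup>k h(\<sigma>\<omega>, \<omega>\<^sup>k)\<close> turns square-integrable functions on \<open>Hk k\<close> into
  square-integrable functions upstairs, and these satisfy the sub-mean value inequality across the puncture,
  since it is a removable singularity for them. Upstairs \<open>PP\<close> is, up to the Jacobian, a product of Bergman
  kernels of the disc in \<open>\<sigma>\<^sup>k\<close> and \<open>\<omega>\<^sup>k\<close>, and \<open>BergK\<close> is \<open>PP\<close> times a bounded factor that is bounded away from zero near the
  diagonal (though it may vanish elsewhere). So both kernels, applied to a Carleson measure, have bounded transforms;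
  and conversely, sub-mean value inequality, lower bound near the diagonal and Tonelli give
  \<open>\<integral> |h|\<^sup>2 d\<mu> \<le> C \<integral> |h|\<^sup>2 T\<^sub>\<mu> dV\<close>, and likewise with the Berezin transform.
\<close>

section \<open>Change of variables for injective holomorphic maps\<close>

text \<open>The obstacle is the singular boundary point at the origin. The neighbourhoods used for
  the sub-mean value inequality have radii proportional to the distance to the unit circle, so in
  the second coordinate they may contain the puncture \<open>\<omega> = 0\<close>. If the integral
  there is finite, square-integrability removes the singularity; if it is infinite, the inequality
  is trivial. The reproducing property of \<open>BergK\<close> is never invoked. Only its formula
  enters, and its diagonal values act as a normalisation comparable to those of \<open>PP\<close>. A
  neighbourhood is taken around every point, so no lattice or covering argument is required: the
  sub-mean value inequality is integrated against \<open>\<mu>\<close>, and Tonelli exchanges the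
  centre with the point running through its neighbourhood. As constants are free, the k-to-one
  covering is handled by two one-sided integral inequalities, one of which loses a factor
  \<open>k\<close>.\<close>

definition vec2_of :: "complex \<Rightarrow> real^2" where
  "vec2_of z = (\<chi> i. if i = 1 then Re z else Im z)"

definition of_vec2 :: "real^2 \<Rightarrow> complex" where
  "of_vec2 x = Complex (x $ 1) (x $ 2)"

lemma of_vec2_vec2_of [simp]: "of_vec2 (vec2_of z) = z"
  by (simp add: vec2_of_def of_vec2_def complex_eq_iff)

lemma vec2_of_of_vec2 [simp]: "vec2_of (of_vec2 x) = x"
  by (simp add: vec2_of_def of_vec2_def vec_eq_iff forall_2)

lemma linear_of_vec2: "linear of_vec2"
  by (auto intro!: linearI simp: of_vec2_def complex_eq_iff)

lemma linear_vec2_of: "linear vec2_of"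
  by (auto intro!: linearI simp: vec2_of_def vec_eq_iff)

lemma borel_measurable_of_vec2 [measurable]: "of_vec2 \<in> borel_measurable borel"
  by (intro borel_measurable_continuous_onI linear_continuous_on linear_conv_bounded_linear[THEN iffD1] linear_of_vec2)

lemma prod_Basis_vec2: "(\<Prod>b\<in>(Basis :: (real^2) set). F b) = F (axis 1 1) * F (axis 2 1)"
proof -
  have B: "(Basis :: (real^2) set) = {axis 1 1, axis 2 1}"
    by (auto simp: Basis_vec_def UNIV_2)
  have "axis 1 (1::real) \<noteq> (axis 2 1 :: real^2)"
    by (simp add: axis_eq_axis)
  then show ?thesis
    unfolding B by simp
qed

text \<open>Lebesgue measure is determined by its values on boxes, and \<open>of_vec2\<close>
  matches boxes with boxes. This moves integrals to \<open>real^2\<close>, where Jacobians are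
  determinants of matrices.\<close>

lemma lborel_complex_eq_distr: "lborel = distr lborel borel of_vec2"
proof (rule lborel_eqI)
  fix l u :: complex
  assume le: "\<And>b. b \<in> Basis \<Longrightarrow> l \<bullet> b \<le> u \<bullet> b"
  have *: "Re l \<le> Re u" "Im l \<le> Im u"
    using le[of 1] le[of \<i>] by (auto simp: Basis_complex_def)
  have "of_vec2 -` box l u = box (vec2_of l) (vec2_of u)"
    by (auto simp: box_def Basis_complex_def of_vec2_def vec2_of_def Basis_vec_def inner_axis UNIV_2)
  moreover have "emeasure lborel (box (vec2_of l) (vec2_of u)) = (\<Prod>b\<in>Basis. (vec2_of u - vec2_of l) \<bullet> b)"
    using * by (intro emeasure_lborel_box) (auto simp: Basis_vec_def inner_axis vec2_of_def)
  ultimately show "emeasure (distr lborel borel of_vec2) (box l u) = ennreal (\<Prod>b\<in>Basis. (u - l) \<bullet> b)"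
    by (simp add: emeasure_distr prod_Basis_vec2 inner_axis Basis_complex_def vec2_of_def)
qed simp

lemma nn_integral_complex_eq_vec2:
  assumes "f \<in> borel_measurable borel"
  shows "(\<integral>\<^sup>+ z. f z \<partial>lborel) = (\<integral>\<^sup>+ x. f (of_vec2 x) \<partial>lborel)"
  using assms by (subst lborel_complex_eq_distr) (simp add: nn_integral_distr)

lemma emeasure_complex_eq_vec2:
  assumes "A \<in> sets borel"
  shows "emeasure lborel A = emeasure lborel (of_vec2 -` A)"
  using assms by (subst lborel_complex_eq_distr) (simp add: emeasure_distr)

text \<open>Multiplication by \<open>c\<close> is a rotation followed by a dilation; hence the real
  Jacobian of a holomorphic map is the squared modulus of its derivative.\<close>

lemma det_matrix_complex_mult:
  "\<bar>det (matrix (\<lambda>x. vec2_of (c * of_vec2 x)))\<bar> = (cmod c)\<^sup>2"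
proof -
  have "det (matrix (\<lambda>x. vec2_of (c * of_vec2 x))) = (cmod c)\<^sup>2"
    unfolding cmod_power2 by (simp add: det_2 matrix_def vec2_of_def of_vec2_def axis_def power2_eq_square)
  then show ?thesis by simp
qed

text \<open>Boundedness makes the measure of the image finite, as the real change of variables asks;
  exhaustion lifts this restriction afterwards.\<close>

lemma emeasure_complex_image_bounded:
  fixes f f' :: "complex \<Rightarrow> complex"
  assumes S: "S \<in> sets borel" and [measurable]: "f' \<in> borel_measurable borel"
    and der: "\<And>z. z \<in> S \<Longrightarrow> (f has_field_derivative f' z) (at z within S)"
    and inj: "inj_on f S" and im: "f ` S \<in> sets borel" and bdd: "bounded (f ` S)"
  shows "(\<integral>\<^sup>+ z\<in>S. ennreal ((cmod (f' z))\<^sup>2) \<partial>lborel) = emeasure lborel (f ` S)"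
proof -
  let ?S = "of_vec2 -` S" and ?f = "\<lambda>x. vec2_of (f (of_vec2 x))"
  let ?f' = "\<lambda>x h. vec2_of (f' (of_vec2 x) * of_vec2 h)"
  have S': "?S \<in> sets borel"
    using measurable_sets[OF borel_measurable_of_vec2 S] by simp
  have imS: "?f ` ?S = of_vec2 -` (f ` S)"
    by (auto simp: image_iff) (metis of_vec2_vec2_of vec2_of_of_vec2 vimageI2)
  have im': "?f ` ?S \<in> sets borel"
    unfolding imS using measurable_sets[OF borel_measurable_of_vec2 im] by simp
  have eqf: "f ` S = of_vec2 ` (?f ` ?S)"
    unfolding imS by (metis of_vec2_vec2_of surj_def surj_image_vimage_eq)
  have "bounded (vec2_of ` (f ` S))"
    by (intro bounded_linear_image bdd linear_conv_bounded_linear[THEN iffD1] linear_vec2_of)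
  moreover have "vec2_of ` (f ` S) = ?f ` ?S"
    unfolding imS by (auto simp: image_iff) (metis vec2_of_of_vec2)+
  ultimately have bdd': "bounded (?f ` ?S)" by simp
  have lm: "?f ` ?S \<in> lmeasurable"
    using im' bdd' by (intro bounded_set_imp_lmeasurable) auto
  have der': "(?f has_derivative ?f' x) (at x within ?S)" if "x \<in> ?S" for x
  proof -
    have "(of_vec2 has_derivative of_vec2) (at x within ?S)"
      using linear_of_vec2 by (simp add: bounded_linear_imp_has_derivative linear_conv_bounded_linear)
    moreover have "(f has_derivative (*) (f' (of_vec2 x))) (at (of_vec2 x) within of_vec2 ` ?S)"
      using der[of "of_vec2 x"] that unfolding has_field_derivative_def
      by (rule_tac has_derivative_subset[where s=S]) auto
    ultimately have "((\<lambda>x. f (of_vec2 x)) has_derivative (\<lambda>h. f' (of_vec2 x) * of_vec2 h)) (at x within ?S)"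
      by (rule has_derivative_in_compose)
    then show ?thesis
      by (rule bounded_linear.has_derivative[rotated])
         (use linear_vec2_of in \<open>simp add: linear_conv_bounded_linear\<close>)
  qed
  have inj': "inj_on ?f ?S"
    using inj unfolding inj_on_def by (metis of_vec2_vec2_of vec2_of_of_vec2 vimageE)
  have "((\<lambda>x. \<bar>det (matrix (?f' x))\<bar>) has_integral measure lebesgue (?f ` ?S)) ?S"
    using has_measure_differentiable_image[of ?S ?f ?f', OF _ der' inj'] S' lm by auto
  then have "((\<lambda>x. (cmod (f' (of_vec2 x)))\<^sup>2) has_integral measure lebesgue (?f ` ?S)) ?S"
    by (simp only: det_matrix_complex_mult)
  from nn_integral_has_integral_lebesgue'[OF _ this]
  have "(\<integral>\<^sup>+ x\<in>?S. ennreal ((cmod (f' (of_vec2 x)))\<^sup>2) \<partial>lborel) = ennreal (measure lebesgue (?f ` ?S))"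
    by auto
  also have "\<dots> = emeasure lebesgue (?f ` ?S)"
    using lm by (simp add: emeasure_eq_measure2)
  also have "\<dots> = emeasure lborel (?f ` ?S)"
    using im' by simp
  also have "\<dots> = emeasure lborel (f ` S)"
    using im by (simp add: emeasure_complex_eq_vec2 imS)
  also have "(\<integral>\<^sup>+ x\<in>?S. ennreal ((cmod (f' (of_vec2 x)))\<^sup>2) \<partial>lborel) =
      (\<integral>\<^sup>+ z\<in>S. ennreal ((cmod (f' z))\<^sup>2) \<partial>lborel)"
    using S by (subst nn_integral_complex_eq_vec2) (auto intro!: nn_integral_cong simp: indicator_def)
  finally show ?thesis .
qed

text \<open>Two Borel measures are compared: the image under \<open>f\<close> of the density
  \<open>|f'|^2\<close> on \<open>S\<close>, and Lebesgue measure on \<open>T\<close>. They agree on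
  bounded sets, hence everywhere, and then integrate \<open>g\<close> equally. \<open>S\<close> is
  an arbitrary Borel set because the root sheets below are in general not open.\<close>

lemma nn_integral_complex_substitution:
  fixes f f' :: "complex \<Rightarrow> complex" and g :: "complex \<Rightarrow> ennreal"
  assumes S [measurable]: "S \<in> sets borel" and T [measurable]: "T \<in> sets borel"
    and f [measurable]: "f \<in> borel_measurable borel" and f' [measurable]: "f' \<in> borel_measurable borel"
    and g [measurable]: "g \<in> borel_measurable borel"
    and der: "\<And>z. z \<in> S \<Longrightarrow> (f has_field_derivative f' z) (at z within S)"
    and bij: "bij_betw f S T"
  shows "(\<integral>\<^sup>+ z\<in>S. g (f z) * ennreal ((cmod (f' z))\<^sup>2) \<partial>lborel) = (\<integral>\<^sup>+ z\<in>T. g z \<partial>lborel)"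
proof -
  let ?M = "distr (density lborel (\<lambda>z. ennreal ((cmod (f' z))\<^sup>2) * indicator S z)) borel f"
  let ?N = "density lborel (indicator T) :: complex measure"
  have bounded_case: "emeasure ?M A = emeasure ?N A" if A[measurable]: "A \<in> sets borel" and "bounded A" for A
  proof -
    have [measurable]: "f -` A \<in> sets borel"
      using measurable_sets[OF f A] by simp
    have im: "f ` (S \<inter> f -` A) = T \<inter> A"
      using bij by (auto simp: bij_betw_def)
    have "emeasure ?M A = (\<integral>\<^sup>+ z. ennreal ((cmod (f' z))\<^sup>2) * indicator S z * indicator (f -` A) z \<partial>lborel)"
      by (simp add: emeasure_distr emeasure_density)
    also have "\<dots> = (\<integral>\<^sup>+ z\<in>S \<inter> f -` A. ennreal ((cmod (f' z))\<^sup>2) \<partial>lborel)"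
      by (intro nn_integral_cong) (auto simp: indicator_def)
    also have "\<dots> = emeasure lborel (f ` (S \<inter> f -` A))"
    proof (rule emeasure_complex_image_bounded)
      show "(f has_field_derivative f' z) (at z within S \<inter> f -` A)" if "z \<in> S \<inter> f -` A" for z
        using that by (intro DERIV_subset[OF der]) auto
      show "inj_on f (S \<inter> f -` A)"
        using bij by (auto simp: bij_betw_def inj_on_def)
      show "bounded (f ` (S \<inter> f -` A))"
        using \<open>bounded A\<close> by (rule bounded_subset) auto
      show "f ` (S \<inter> f -` A) \<in> sets borel"
        unfolding im by measurable
    qed measurable
    also have "\<dots> = emeasure ?N A"
      by (simp add: im emeasure_density nn_integral_indicator flip: indicator_inter_arith)
    finally show ?thesis .
  qed
  have "?M = ?N"
  proof (rule measure_eqI)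
    fix A assume "A \<in> sets ?M"
    then have A[measurable]: "A \<in> sets borel" by simp
    have inc: "incseq (\<lambda>n. A \<inter> ball 0 (real n))"
      by (auto simp: incseq_def)
    have A_eq: "A = (\<Union>n. A \<inter> ball 0 (real n))"
      by (auto simp: reals_Archimedean2)
    have "emeasure ?M A = (SUP n. emeasure ?M (A \<inter> ball 0 (real n)))"
      by (subst A_eq, subst SUP_emeasure_incseq) (auto intro: inc)
    also have "\<dots> = (SUP n. emeasure ?N (A \<inter> ball 0 (real n)))"
      by (subst bounded_case) (auto simp: bounded_Int)
    also have "\<dots> = emeasure ?N A"
      by (subst (2) A_eq, subst SUP_emeasure_incseq) (auto intro: inc)
    finally show "emeasure ?M A = emeasure ?N A" .
  qed simp
  then have "(\<integral>\<^sup>+ z. g z \<partial>?M) = (\<integral>\<^sup>+ z. g z \<partial>?N)" by simp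
  then show ?thesis
    by (simp add: nn_integral_distr nn_integral_density mult_ac)
qed

section \<open>Sub-mean value property of square-integrable holomorphic functions\<close>

lemma nn_integral_complex_affine:
  fixes g :: "complex \<Rightarrow> ennreal"
  assumes [measurable]: "g \<in> borel_measurable borel" and c: "c \<noteq> 0"
  shows "(\<integral>\<^sup>+ z. g (a + c * z) * ennreal ((cmod c)\<^sup>2) \<partial>lborel) = (\<integral>\<^sup>+ z. g z \<partial>lborel)"
proof -
  have "bij_betw (\<lambda>z. a + c * z) UNIV UNIV"
    using c by (intro bij_betw_byWitness[where f' = "\<lambda>z. (z - a) / c"]) auto
  moreover have "((\<lambda>z. a + c * z) has_field_derivative c) (at z)" for z
    by (auto intro!: derivative_eq_intros)
  ultimately show ?thesis
    using nn_integral_complex_substitution[of UNIV UNIV "\<lambda>z. a + c * z" "\<lambda>_. c" g] by simp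
qed

text \<open>Cauchy's formula for \<open>u \<mapsto> f (a + u * w)\<close> on the unit circle.
  Writing the circle as \<open>cis (2 * pi * x) * w\<close> keeps the angle \<open>x\<close> and the
  point \<open>w\<close> independent, so that Tonelli can later integrate over \<open>w\<close> at a
  fixed angle.\<close>

lemma circle_mean_norm_le:
  assumes f: "f holomorphic_on ball a r" and w: "cmod w < r"
  shows "ennreal (cmod (f a)) \<le> (\<integral>\<^sup>+ x\<in>{0..1}. ennreal (cmod (f (a + cis (2 * pi * x) * w))) \<partial>lborel)"
proof -
  let ?f = "\<lambda>u. f (a + u * w)"
  have sub: "(\<lambda>u. a + u * w) ` cball 0 1 \<subseteq> ball a r"
  proof clarify
    fix u :: complex assume "u \<in> cball 0 1"
    then have "cmod (u * w) \<le> 1 * cmod w"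
      unfolding norm_mult by (intro mult_right_mono) auto
    then show "a + u * w \<in> ball a r"
      using w by (simp add: dist_norm)
  qed
  have hol: "?f holomorphic_on cball 0 1"
    using holomorphic_on_compose_gen[OF _ f sub] by (simp add: o_def holomorphic_intros)
  have cis: "exp (2 * complex_of_real pi * \<i> * complex_of_real x) = cis (2 * pi * x)" for x
    by (simp add: cis_conv_exp mult_ac)
  have circlepath_01: "circlepath 0 1 x = cis (2 * pi * x)" for x
    by (simp add: circlepath cis)
  have cont: "continuous_on {0..1} (\<lambda>x. ?f (cis (2 * pi * x)))"
    by (intro continuous_on_compose2[OF holomorphic_on_imp_continuous_on[OF hol]] continuous_intros) auto
  have "((\<lambda>u. ?f u / (u - 0)) has_contour_integral (2 * of_real pi * \<i> * ?f 0)) (circlepath 0 1)"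
    by (rule Cauchy_integral_circlepath_simple[OF hol]) auto
  then have "((\<lambda>x. ?f (cis (2 * pi * x)) / cis (2 * pi * x) * (2 * of_real pi * \<i> * cis (2 * pi * x)))
      has_integral (2 * of_real pi * \<i> * f (a + 0 * w))) {0..1}"
    unfolding has_contour_integral_def
    by (rule has_integral_eq[rotated])
       (simp add: vector_derivative_circlepath01 cis circlepath_01)
  from has_integral_divide[OF this, of "2 * of_real pi * \<i>"]
  have int: "((\<lambda>x. ?f (cis (2 * pi * x))) has_integral f a) {0..1}"
    by (rule has_integral_eq_rhs[OF has_integral_eq[rotated]]) auto
  have int_norm: "((\<lambda>x. cmod (?f (cis (2 * pi * x)))) has_integral
      integral {0..1} (\<lambda>x. cmod (?f (cis (2 * pi * x))))) {0..1}"
    by (intro integrable_integral integrable_continuous_interval continuous_intros cont)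
  have "cmod (f a) \<le> integral {0..1} (\<lambda>x. cmod (?f (cis (2 * pi * x))))"
    using int int_norm by (auto simp: has_integral_iff dest: integral_norm_bound_integral[where g="\<lambda>x. cmod (?f (cis (2 * pi * x)))"])
  then have "ennreal (cmod (f a)) \<le> ennreal (integral {0..1} (\<lambda>x. cmod (?f (cis (2 * pi * x)))))"
    by (rule ennreal_leI)
  also have "\<dots> = (\<integral>\<^sup>+ x\<in>{0..1}. ennreal (cmod (?f (cis (2 * pi * x)))) \<partial>lborel)"
    by (rule nn_integral_has_integral_lebesgue'[symmetric, OF _ int_norm]) auto
  finally show ?thesis .
qed

lemma emeasure_complex_ball: "r \<ge> 0 \<Longrightarrow> emeasure lborel (ball (a :: complex) r) = ennreal (pi * r\<^sup>2)"
  by (simp add: emeasure_ball eval_unit_ball_vol)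

lemma borel_measurable_norm_square_indicator:
  fixes f :: "'a :: topological_space \<Rightarrow> complex"
  assumes "open S" "continuous_on S f"
  shows "(\<lambda>z. ennreal ((cmod (f z))\<^sup>2) * indicator S z) \<in> borel_measurable borel"
proof -
  have "(\<lambda>z. indicator S z *\<^sub>R f z) \<in> borel_measurable borel"
    using assms by (intro borel_measurable_continuous_on_indicator) auto
  then have "(\<lambda>z. ennreal ((cmod (indicator S z *\<^sub>R f z))\<^sup>2)) \<in> borel_measurable borel"
    by measurable
  moreover have "(\<lambda>z. ennreal ((cmod (indicator S z *\<^sub>R f z))\<^sup>2)) = (\<lambda>z. ennreal ((cmod (f z))\<^sup>2) * indicator S z)"
    by (auto simp: indicator_def)
  ultimately show ?thesis by metis
qed

text \<open>The circle mean is applied to \<open>f\<^sup>2\<close>; averaging over rotations about \<open>a\<close>,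
  which preserve area, replaces polar coordinates.\<close>
lemma submean_square_ball:
  assumes f: "f holomorphic_on ball a r" and r: "r > 0"
  shows "ennreal (pi * r\<^sup>2 * (cmod (f a))\<^sup>2) \<le> (\<integral>\<^sup>+ z\<in>ball a r. ennreal ((cmod (f z))\<^sup>2) \<partial>lborel)"
proof -
  define F where "F z = ennreal ((cmod (f z))\<^sup>2) * indicator (ball a r) z" for z
  have F [measurable]: "F \<in> borel_measurable borel"
    unfolding F_def by (intro borel_measurable_norm_square_indicator holomorphic_on_imp_continuous_on f) auto
  have rot: "(\<integral>\<^sup>+ w. F (a + cis x * w) \<partial>lborel) = (\<integral>\<^sup>+ z. F z \<partial>lborel)" for x
    using nn_integral_complex_affine[OF F, of "cis x" a] by simp
  have [measurable]: "(\<lambda>x. cis (2 * pi * x)) \<in> borel_measurable borel"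
    by (intro borel_measurable_continuous_onI continuous_intros)
  have f2: "(\<lambda>z. (f z)\<^sup>2) holomorphic_on ball a r"
    by (intro holomorphic_intros f)
  have mean: "ennreal ((cmod (f a))\<^sup>2) * indicator (ball 0 r) w
      \<le> (\<integral>\<^sup>+ x\<in>{0..1}. F (a + cis (2 * pi * x) * w) \<partial>lborel)" for w
  proof (cases "cmod w < r")
    case True
    have "ennreal (cmod ((f a)\<^sup>2)) \<le> (\<integral>\<^sup>+ x\<in>{0..1}. ennreal (cmod ((f (a + cis (2 * pi * x) * w))\<^sup>2)) \<partial>lborel)"
      by (rule circle_mean_norm_le[OF f2 True])
    also have "\<dots> = (\<integral>\<^sup>+ x\<in>{0..1}. F (a + cis (2 * pi * x) * w) \<partial>lborel)"
      using True by (intro nn_integral_cong) (auto simp: F_def norm_power dist_norm norm_mult)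
    finally show ?thesis
      using True by (simp add: norm_power)
  qed auto
  have "ennreal (pi * r\<^sup>2 * (cmod (f a))\<^sup>2) = (\<integral>\<^sup>+ w. ennreal ((cmod (f a))\<^sup>2) * indicator (ball (0::complex) r) w \<partial>lborel)"
    using r by (subst nn_integral_cmult_indicator) (auto simp: emeasure_complex_ball ennreal_mult mult_ac)
  also have "\<dots> \<le> (\<integral>\<^sup>+ w. (\<integral>\<^sup>+ x\<in>{0..1}. F (a + cis (2 * pi * x) * w) \<partial>lborel) \<partial>lborel)"
    by (intro nn_integral_mono mean)
  also have "\<dots> = (\<integral>\<^sup>+ x. (\<integral>\<^sup>+ w. F (a + cis (2 * pi * x) * w) * indicator {0..1} x \<partial>lborel) \<partial>lborel)"
    by (intro lborel_pair.Fubini') measurable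
  also have "\<dots> = (\<integral>\<^sup>+ x. (\<integral>\<^sup>+ z. F z \<partial>lborel) * indicator {0..1::real} x \<partial>lborel)"
    by (intro nn_integral_cong) (simp add: nn_integral_multc rot)
  also have "\<dots> = (\<integral>\<^sup>+ z. F z \<partial>lborel)"
    by (simp add: nn_integral_cmult_indicator)
  finally show ?thesis
    by (simp add: F_def)
qed

text \<open>Along a sequence tending to \<open>b\<close>, the sub-mean value inequality is applied
  on the balls around \<open>X n\<close> whose boundary passes through \<open>b\<close>. Their
  squared radius is \<open>|X n - b|^2\<close>, and the integrals of \<open>|f|^2\<close> over them
  vanish in the limit by dominated convergence.\<close>

lemma square_integrable_puncture_tendsto_0:
  assumes f: "f holomorphic_on ball a r - {b}" and b: "b \<in> ball a r"
    and fin: "(\<integral>\<^sup>+ z\<in>ball a r - {b}. ennreal ((cmod (f z))\<^sup>2) \<partial>lborel) < \<infinity>"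
  shows "((\<lambda>z. (z - b) * f z) \<longlongrightarrow> 0) (at b)"
  unfolding tendsto_at_iff_sequentially comp_def
proof safe
  fix X :: "nat \<Rightarrow> complex"
  assume X: "\<forall>i. X i \<in> UNIV - {b}" and lim: "X \<longlonglongrightarrow> b"
  define F where "F z = ennreal ((cmod (f z))\<^sup>2) * indicator (ball a r - {b}) z" for z
  have F [measurable]: "F \<in> borel_measurable borel"
    unfolding F_def by (intro borel_measurable_norm_square_indicator holomorphic_on_imp_continuous_on f) auto
  define d where "d n = dist (X n) b" for n
  have d0: "d \<longlonglongrightarrow> 0"
    unfolding d_def using lim by (simp add: tendsto_dist_iff[symmetric])
  have "(\<lambda>n. \<integral>\<^sup>+ z. F z * indicator (ball (X n) (d n)) z \<partial>lborel) \<longlonglongrightarrow> (\<integral>\<^sup>+ z. 0 \<partial>(lborel :: complex measure))"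
  proof (rule nn_integral_dominated_convergence[where w = F])
    show "(\<integral>\<^sup>+ z. F z \<partial>lborel) < \<infinity>"
      using fin by (simp add: F_def)
    show "AE z in lborel. (\<lambda>n. F z * indicator (ball (X n) (d n)) z) \<longlonglongrightarrow> 0"
    proof (intro AE_I2 tendsto_eventually)
      fix z
      show "\<forall>\<^sub>F n in sequentially. F z * indicator (ball (X n) (d n)) z = 0"
      proof (cases "z = b")
        case False
        \<comment> \<open>The ball around \<open>X n\<close> lies within \<open>2 * d n\<close> of
          \<open>b\<close>, so a fixed \<open>z \<noteq> b\<close> eventually falls outside.\<close>
        then have "\<forall>\<^sub>F n in sequentially. d n < dist z b / 2"
          by (intro order_tendstoD[OF d0]) auto
        then show ?thesis
        proof eventually_elim
          case (elim n)
          then have "z \<notin> ball (X n) (d n)"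
            using dist_triangle[of z b "X n"] by (auto simp: d_def dist_commute)
          then show ?case by simp
        qed
      qed (simp add: F_def)
    qed
  qed (auto simp: indicator_def)
  then have lim0: "(\<lambda>n. \<integral>\<^sup>+ z. F z * indicator (ball (X n) (d n)) z \<partial>lborel) \<longlonglongrightarrow> 0"
    by simp
  have ev: "\<forall>\<^sub>F n in sequentially. ball (X n) (d n) \<subseteq> ball a r - {b}"
  proof -
    obtain e where e: "e > 0" "ball b e \<subseteq> ball a r"
      using b open_ball open_contains_ball by metis
    have "\<forall>\<^sub>F n in sequentially. d n < e / 2"
      by (intro order_tendstoD[OF d0]) (use e in auto)
    then show ?thesis
    proof eventually_elim
      case (elim n)
      show ?case
      proof
        fix z assume z: "z \<in> ball (X n) (d n)"
        then have "dist b z < e"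
          using elim dist_triangle[of b z "X n"] by (auto simp: d_def dist_commute)
        with z e show "z \<in> ball a r - {b}"
          by (auto simp: d_def)
      qed
    qed
  qed
  have "(\<lambda>n. ennreal (pi * (cmod ((X n - b) * f (X n)))\<^sup>2)) \<longlonglongrightarrow> 0"
  proof (rule tendsto_sandwich[OF _ _ tendsto_const lim0])
    show "\<forall>\<^sub>F n in sequentially. ennreal (pi * (cmod ((X n - b) * f (X n)))\<^sup>2)
        \<le> (\<integral>\<^sup>+ z. F z * indicator (ball (X n) (d n)) z \<partial>lborel)"
      using ev
    proof eventually_elim
      case (elim n)
      have "f holomorphic_on ball (X n) (d n)"
        using f elim by (rule holomorphic_on_subset)
      moreover have "d n > 0"
        using X by (simp add: d_def)
      ultimately have "ennreal (pi * (d n)\<^sup>2 * (cmod (f (X n)))\<^sup>2)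
          \<le> (\<integral>\<^sup>+ z\<in>ball (X n) (d n). ennreal ((cmod (f z))\<^sup>2) \<partial>lborel)"
        by (rule submean_square_ball)
      also have "\<dots> = (\<integral>\<^sup>+ z. F z * indicator (ball (X n) (d n)) z \<partial>lborel)"
        using elim by (intro nn_integral_cong) (auto simp: F_def indicator_def)
      finally show ?case
        by (simp add: d_def dist_norm norm_mult power_mult_distrib mult_ac)
    qed
  qed auto
  then have "(\<lambda>n. pi * (cmod ((X n - b) * f (X n)))\<^sup>2) \<longlonglongrightarrow> 0"
    by (simp add: ennreal_tendsto_0_iff)
  from tendsto_mult_left[OF this, of "1 / pi"]
  have "(\<lambda>n. (cmod ((X n - b) * f (X n)))\<^sup>2) \<longlonglongrightarrow> 0"
    by simp
  from tendsto_real_sqrt[OF this]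
  have "(\<lambda>n. cmod ((X n - b) * f (X n))) \<longlonglongrightarrow> 0"
    by simp
  then show "(\<lambda>n. (X n - b) * f (X n)) \<longlonglongrightarrow> 0"
    by (rule tendsto_norm_zero_cancel)
qed

text \<open>With a puncture inside the ball and a finite integral, Riemann's theorem extends
  \<open>f\<close> and the plain inequality applies to the extension, the point \<open>b\<close>
  being a null set. An infinite integral leaves nothing to show, and a puncture outside the ball
  changes nothing.\<close>

lemma submean_square_punctured_ball:
  assumes f: "f holomorphic_on ball a r - {b}" and r: "r > 0" and ab: "a \<noteq> b"
  shows "ennreal (pi * r\<^sup>2 * (cmod (f a))\<^sup>2) \<le> (\<integral>\<^sup>+ z\<in>ball a r - {b}. ennreal ((cmod (f z))\<^sup>2) \<partial>lborel)"
proof (cases "b \<in> ball a r \<and> (\<integral>\<^sup>+ z\<in>ball a r - {b}. ennreal ((cmod (f z))\<^sup>2) \<partial>lborel) < \<infinity>")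
  case True
  then have "((\<lambda>z. (z - b) * f z) \<longlongrightarrow> 0) (at b)"
    using f by (intro square_integrable_puncture_tendsto_0) auto
  then obtain g where g: "g holomorphic_on ball a r" "\<forall>z\<in>ball a r - {b}. g z = f z"
    using holomorphic_on_extend_lim[OF f] True by auto
  have "ennreal (pi * r\<^sup>2 * (cmod (g a))\<^sup>2) \<le> (\<integral>\<^sup>+ z\<in>ball a r. ennreal ((cmod (g z))\<^sup>2) \<partial>lborel)"
    by (rule submean_square_ball[OF g(1) r])
  also have "\<dots> = (\<integral>\<^sup>+ z\<in>ball a r - {b}. ennreal ((cmod (f z))\<^sup>2) \<partial>lborel)"
    using AE_lborel_singleton[of b] g(2) by (intro nn_integral_cong_AE) (auto simp: indicator_def)
  finally show ?thesis
    using g(2) r ab by simp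
next
  case False
  show ?thesis
  proof (cases "b \<in> ball a r")
    case True
    with False show ?thesis
      by (metis infinity_ennreal_def less_top top_greatest)
  next
    case b: False
    then have "ball a r - {b} = ball a r" by simp
    with f r show ?thesis
      by (simp add: submean_square_ball)
  qed
qed

section \<open>The branched covering of the Hartogs triangle\<close>

text \<open>The principal branch: discontinuous along the negative axis, but Borel, which is what
  the substitution asks for.\<close>

definition croot :: "nat \<Rightarrow> complex \<Rightarrow> complex" where
  "croot k z = exp (Ln z / of_nat k)"

lemma croot_nonzero [simp]: "croot k z \<noteq> 0"
  by (simp add: croot_def)

lemma croot_power: "k \<ge> 1 \<Longrightarrow> z \<noteq> 0 \<Longrightarrow> croot k z ^ k = z"
  by (simp add: croot_def flip: exp_of_nat_mult)

lemma borel_measurable_croot [measurable]: "croot k \<in> borel_measurable borel"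
proof -
  have "(\<lambda>z::complex. exp z) \<in> borel_measurable borel"
    by (intro borel_measurable_continuous_onI continuous_intros)
  then show ?thesis
    unfolding croot_def[abs_def] by measurable
qed

text \<open>For a \<open>k\<close>-th root of unity \<open>c\<close>, this is a half-open sector on
  which \<open>w \<mapsto> w ^ k\<close> has the inverse
  \<open>v \<mapsto> c * croot k v\<close>.\<close>

definition root_sheet :: "nat \<Rightarrow> complex \<Rightarrow> complex set" where
  "root_sheet k c = {w. w \<noteq> 0 \<and> w = c * croot k (w ^ k)}"

lemma root_sheet_sets [measurable]: "root_sheet k c \<in> sets borel"
  unfolding root_sheet_def by measurable

lemma bij_betw_root_sheet:
  assumes k: "k \<ge> 1" and c: "c ^ k = 1"
  shows "bij_betw (\<lambda>w. w ^ k) (root_sheet k c) (- {0})"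
proof -
  have "c \<noteq> 0"
    using c k by (auto simp: zero_power)
  show ?thesis
    by (rule bij_betw_byWitness[where f' = "\<lambda>v. c * croot k v"])
       (use k c \<open>c \<noteq> 0\<close> in \<open>auto simp: root_sheet_def croot_power power_mult_distrib\<close>)
qed

lemma nn_integral_root_sheet:
  fixes F :: "complex \<Rightarrow> ennreal"
  assumes k: "k \<ge> 1" and c: "c ^ k = 1" and [measurable]: "F \<in> borel_measurable borel"
  shows "(\<integral>\<^sup>+ w\<in>root_sheet k c. F (w ^ k) * ennreal ((cmod (of_nat k * w ^ (k - 1)))\<^sup>2) \<partial>lborel)
    = (\<integral>\<^sup>+ v. F v \<partial>lborel)"
proof -
  have "(\<integral>\<^sup>+ w\<in>root_sheet k c. F (w ^ k) * ennreal ((cmod (of_nat k * w ^ (k - 1)))\<^sup>2) \<partial>lborel)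
      = (\<integral>\<^sup>+ v\<in>- {0}. F v \<partial>lborel)"
    by (intro nn_integral_complex_substitution bij_betw_root_sheet assms)
       (auto intro!: derivative_eq_intros)
  also have "\<dots> = (\<integral>\<^sup>+ v. F v \<partial>lborel)"
  proof (rule nn_integral_cong_AE)
    show "AE v in lborel. F v * indicator (- {0}) v = F v"
      using AE_lborel_singleton[of "0::complex"] by eventually_elim simp
  qed
  finally show ?thesis .
qed

text \<open>The single sheet \<open>c = 1\<close> is already mapped onto the punctured
  plane.\<close>

lemma nn_integral_power_substitution_le:
  fixes F :: "complex \<Rightarrow> ennreal"
  assumes k: "k \<ge> 1" and [measurable]: "F \<in> borel_measurable borel"
  shows "(\<integral>\<^sup>+ v. F v \<partial>lborel) \<le> (\<integral>\<^sup>+ w. F (w ^ k) * ennreal ((cmod (of_nat k * w ^ (k - 1)))\<^sup>2) \<partial>lborel)"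
proof -
  have "(\<integral>\<^sup>+ v. F v \<partial>lborel)
      = (\<integral>\<^sup>+ w\<in>root_sheet k 1. F (w ^ k) * ennreal ((cmod (of_nat k * w ^ (k - 1)))\<^sup>2) \<partial>lborel)"
    using k by (intro nn_integral_root_sheet[symmetric]) auto
  also have "\<dots> \<le> (\<integral>\<^sup>+ w. F (w ^ k) * ennreal ((cmod (of_nat k * w ^ (k - 1)))\<^sup>2) \<partial>lborel)"
    by (intro nn_integral_mono) (auto simp: indicator_def)
  finally show ?thesis .
qed

text \<open>The sheets belonging to all roots of unity cover the punctured plane, each contributes
  the integral of \<open>F\<close>, and there are at most \<open>k\<close> of them. As only an upper
  bound is claimed, overlaps would do no harm.\<close>

lemma nn_integral_power_substitution_ge:
  fixes F :: "complex \<Rightarrow> ennreal"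
  assumes k: "k \<ge> 1" and [measurable]: "F \<in> borel_measurable borel"
  shows "(\<integral>\<^sup>+ w. F (w ^ k) * ennreal ((cmod (of_nat k * w ^ (k - 1)))\<^sup>2) \<partial>lborel)
    \<le> of_nat k * (\<integral>\<^sup>+ v. F v \<partial>lborel)"
proof -
  let ?R = "{c::complex. c ^ k = 1}"
  let ?G = "\<lambda>w. F (w ^ k) * ennreal ((cmod (of_nat k * w ^ (k - 1)))\<^sup>2)"
  have cover: "?G w \<le> (\<Sum>c\<in>?R. ?G w * indicator (root_sheet k c) w)" if "w \<noteq> 0" for w
  proof -
    \<comment> \<open>The quotient of two \<open>k\<close>-th roots of the same number is a root of
      unity; it names the sheet through \<open>w\<close>.\<close>
    let ?c = "w / croot k (w ^ k)"
    have c: "?c \<in> ?R"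
      using that k by (simp add: power_divide croot_power)
    have "w \<in> root_sheet k ?c"
      using that by (simp add: root_sheet_def)
    then have "?G w = ?G w * indicator (root_sheet k ?c) w" by simp
    also have "\<dots> \<le> (\<Sum>c\<in>?R. ?G w * indicator (root_sheet k c) w)"
      using c k by (intro member_le_sum finite_roots_unity) auto
    finally show ?thesis .
  qed
  have "(\<integral>\<^sup>+ w. ?G w \<partial>lborel) \<le> (\<integral>\<^sup>+ w. (\<Sum>c\<in>?R. ?G w * indicator (root_sheet k c) w) \<partial>lborel)"
  proof (rule nn_integral_mono_AE)
    show "AE w in lborel. ?G w \<le> (\<Sum>c\<in>?R. ?G w * indicator (root_sheet k c) w)"
      using AE_lborel_singleton[of "0::complex"] by eventually_elim (rule cover)
  qed
  also have "\<dots> = (\<Sum>c\<in>?R. \<integral>\<^sup>+ w\<in>root_sheet k c. ?G w \<partial>lborel)"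
    by (rule nn_integral_sum) measurable
  also have "\<dots> = of_nat (card ?R) * (\<integral>\<^sup>+ v. F v \<partial>lborel)"
    by (simp add: nn_integral_root_sheet[OF k] del: One_nat_def)
  also have "\<dots> \<le> of_nat k * (\<integral>\<^sup>+ v. F v \<partial>lborel)"
    using k card_roots_unity[of k, where 'a = complex] by (intro mult_right_mono) (auto simp: of_nat_mono)
  finally show ?thesis .
qed

section \<open>Integration over the Hartogs triangle through the covering\<close>

definition cover_map :: "nat \<Rightarrow> complex \<times> complex \<Rightarrow> complex \<times> complex" where
  "cover_map k a = (fst a * snd a, snd a ^ k)"

definition cover_dom :: "(complex \<times> complex) set" where
  "cover_dom = ball 0 1 \<times> (ball 0 1 - {0})"

lemma cover_map_in_Hk: "k \<ge> 1 \<Longrightarrow> a \<in> cover_dom \<Longrightarrow> cover_map k a \<in> Hk k"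
  by (auto simp: cover_map_def cover_dom_def Hk_def norm_mult norm_power power_mult_distrib
      power_less_one_iff mult_less_cancel_right2 power_le_zero_eq)

lemma open_Hk: "open (Hk k)"
  unfolding Hk_def by (intro open_Collect_conj open_Collect_less continuous_intros)

lemma Hk_sets [measurable]: "Hk k \<in> sets borel"
  using open_Hk by simp

lemma open_cover_dom: "open cover_dom"
  unfolding cover_dom_def by (intro open_Times open_delete) auto

lemma cover_dom_sets [measurable]: "cover_dom \<in> sets borel"
  using open_cover_dom by simp

lemma borel_measurable_cover_map [measurable]: "cover_map k \<in> borel_measurable borel"
  unfolding cover_map_def by (intro borel_measurable_continuous_onI continuous_intros)

lemma fst_borel [measurable]: "fst \<in> borel_measurable (borel :: (complex \<times> complex) measure)"
  and snd_borel [measurable]: "snd \<in> borel_measurable (borel :: (complex \<times> complex) measure)"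
  by (intro borel_measurable_continuous_onI continuous_intros)+

lemma nn_integral_complex_pair:
  fixes G :: "complex \<times> complex \<Rightarrow> ennreal"
  assumes "G \<in> borel_measurable borel"
  shows "(\<integral>\<^sup>+ a. G a \<partial>lborel) = (\<integral>\<^sup>+ y. (\<integral>\<^sup>+ x. G (x, y) \<partial>lborel) \<partial>lborel)"
  using assms by (subst lborel_pair.nn_integral_snd) (auto simp: lborel_prod)

text \<open>The slice of \<open>Hk k\<close> at height \<open>w ^ k\<close> is the disc of radius
  \<open>|w|\<close>, which the dilation \<open>x = w * s\<close> normalises to the unit disc. Its
  Jacobian \<open>|w|^2\<close> times that of the power map gives \<open>k^2 |w|^(2k)\<close>; at
  \<open>w = 0\<close> both sides vanish.\<close>

lemma Hk_slice_eq:
  assumes k: "k \<ge> 1" and F [measurable]: "F \<in> borel_measurable borel"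
  shows "(\<integral>\<^sup>+ x. F (x, w ^ k) * indicator (Hk k) (x, w ^ k) \<partial>lborel) * ennreal ((cmod (of_nat k * w ^ (k - 1)))\<^sup>2)
    = (\<integral>\<^sup>+ s. F (cover_map k (s, w)) * ennreal ((real k)\<^sup>2 * cmod w ^ (2 * k)) * indicator cover_dom (s, w) \<partial>lborel)"
proof (cases "w = 0")
  case True
  have "(x, w ^ k) \<notin> Hk k" "(x, w) \<notin> cover_dom" for x
    using True k by (auto simp: Hk_def cover_dom_def zero_power not_less)
  then show ?thesis
    by simp
next
  case False
  let ?F = "\<lambda>x. F (x, w ^ k) * indicator (Hk k) (x, w ^ k)"
  have [measurable]: "?F \<in> borel_measurable borel"
  proof -
    have [measurable]: "(\<lambda>x. (x, w ^ k)) \<in> borel_measurable borel"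
      by (intro borel_measurable_continuous_onI continuous_intros)
    show ?thesis by measurable
  qed
  have iff: "(s * w, w ^ k) \<in> Hk k \<longleftrightarrow> (s, w) \<in> cover_dom" for s
  proof
    assume "(s * w, w ^ k) \<in> Hk k"
    then have "cmod s ^ k * cmod w ^ k < cmod w ^ k" "cmod w ^ k < 1"
      by (auto simp: Hk_def norm_mult norm_power power_mult_distrib)
    then have "cmod s ^ k < 1" "cmod w ^ k < 1"
      using False by (auto simp: mult_less_cancel_right2)
    then show "(s, w) \<in> cover_dom"
      using False k by (auto simp: cover_dom_def power_less_one_iff)
  next
    assume "(s, w) \<in> cover_dom"
    then show "(s * w, w ^ k) \<in> Hk k"
      using cover_map_in_Hk[OF k] by (force simp: cover_map_def)
  qed
  have weight: "(cmod w)\<^sup>2 * (cmod (of_nat k * w ^ (k - 1)))\<^sup>2 = (real k)\<^sup>2 * cmod w ^ (2 * k)"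
  proof -
    have "cmod w * cmod w ^ (k - 1) = cmod w ^ k"
      using k by (simp flip: power_Suc)
    then show ?thesis
      by (simp add: norm_mult norm_power power_mult_distrib[symmetric] power_mult mult_ac)
  qed
  have "(\<integral>\<^sup>+ x. ?F x \<partial>lborel) = (\<integral>\<^sup>+ s. ?F (0 + w * s) * ennreal ((cmod w)\<^sup>2) \<partial>lborel)"
    using False by (intro nn_integral_complex_affine[symmetric]) auto
  then have "(\<integral>\<^sup>+ x. ?F x \<partial>lborel) * ennreal ((cmod (of_nat k * w ^ (k - 1)))\<^sup>2)
      = (\<integral>\<^sup>+ s. ?F (0 + w * s) * ennreal ((cmod w)\<^sup>2) * ennreal ((cmod (of_nat k * w ^ (k - 1)))\<^sup>2) \<partial>lborel)"
    by (simp only:) (intro nn_integral_multc[symmetric], measurable)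
  also have "\<dots> = (\<integral>\<^sup>+ s. F (cover_map k (s, w)) * ennreal ((real k)\<^sup>2 * cmod w ^ (2 * k)) * indicator cover_dom (s, w) \<partial>lborel)"
  proof (intro nn_integral_cong)
    fix s
    have e: "ennreal ((cmod w)\<^sup>2) * ennreal ((cmod (of_nat k * w ^ (k - 1)))\<^sup>2) = ennreal ((real k)\<^sup>2 * cmod w ^ (2 * k))"
      unfolding weight[symmetric] by (simp only: ennreal_mult' zero_le_power2)
    have "indicator (Hk k) (w * s, w ^ k) = (indicator cover_dom (s, w) :: ennreal)"
      using iff[of s] by (simp add: indicator_def mult.commute)
    then show "?F (0 + w * s) * ennreal ((cmod w)\<^sup>2) * ennreal ((cmod (of_nat k * w ^ (k - 1)))\<^sup>2)
        = F (cover_map k (s, w)) * ennreal ((real k)\<^sup>2 * cmod w ^ (2 * k)) * indicator cover_dom (s, w)"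
      unfolding e[symmetric] by (simp add: cover_map_def mult_ac)
  qed
  finally show ?thesis .
qed

text \<open>Tonelli with the second coordinate outside: the slices upstairs and downstairs agree
  once the Jacobian is attached, and what remains is the power substitution for the slice integral
  \<open>Q\<close>.\<close>

lemma
  fixes F :: "complex \<times> complex \<Rightarrow> ennreal"
  assumes k: "k \<ge> 1" and F [measurable]: "F \<in> borel_measurable borel"
  shows nn_integral_Hk_le_cover: "(\<integral>\<^sup>+ z\<in>Hk k. F z \<partial>lborel)
      \<le> (\<integral>\<^sup>+ a\<in>cover_dom. F (cover_map k a) * ennreal ((real k)\<^sup>2 * cmod (snd a) ^ (2 * k)) \<partial>lborel)" (is ?le)
    and nn_integral_cover_le_Hk: "(\<integral>\<^sup>+ a\<in>cover_dom. F (cover_map k a) * ennreal ((real k)\<^sup>2 * cmod (snd a) ^ (2 * k)) \<partial>lborel)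
      \<le> of_nat k * (\<integral>\<^sup>+ z\<in>Hk k. F z \<partial>lborel)" (is ?ge)
proof -
  define Q where "Q v = (\<integral>\<^sup>+ x. F (x, v) * indicator (Hk k) (x, v) \<partial>lborel)" for v
  have [measurable]: "(\<lambda>(v, x). F (x, v) * indicator (Hk k) (x, v)) \<in> borel_measurable (lborel \<Otimes>\<^sub>M lborel)"
  proof -
    have [measurable]: "(\<lambda>p :: complex \<times> complex. (snd p, fst p)) \<in> borel_measurable borel"
      by (intro borel_measurable_continuous_onI continuous_intros)
    show ?thesis
      unfolding lborel_prod case_prod_beta by measurable
  qed
  have Q [measurable]: "Q \<in> borel_measurable borel"
    unfolding Q_def by measurable
  have 1: "(\<integral>\<^sup>+ z\<in>Hk k. F z \<partial>lborel) = (\<integral>\<^sup>+ v. Q v \<partial>lborel)"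
    unfolding Q_def by (rule nn_integral_complex_pair) measurable
  have "(\<integral>\<^sup>+ a\<in>cover_dom. F (cover_map k a) * ennreal ((real k)\<^sup>2 * cmod (snd a) ^ (2 * k)) \<partial>lborel)
     = (\<integral>\<^sup>+ w. (\<integral>\<^sup>+ s. F (cover_map k (s, w)) * ennreal ((real k)\<^sup>2 * cmod w ^ (2 * k)) * indicator cover_dom (s, w) \<partial>lborel) \<partial>lborel)"
    by (rule trans[OF nn_integral_complex_pair]) (measurable, simp_all add: open_cover_dom)
  also have "\<dots> = (\<integral>\<^sup>+ w. Q (w ^ k) * ennreal ((cmod (of_nat k * w ^ (k - 1)))\<^sup>2) \<partial>lborel)"
    unfolding Q_def by (intro nn_integral_cong Hk_slice_eq[symmetric] k F)
  finally have 2: "(\<integral>\<^sup>+ a\<in>cover_dom. F (cover_map k a) * ennreal ((real k)\<^sup>2 * cmod (snd a) ^ (2 * k)) \<partial>lborel)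
     = (\<integral>\<^sup>+ w. Q (w ^ k) * ennreal ((cmod (of_nat k * w ^ (k - 1)))\<^sup>2) \<partial>lborel)" .
  show ?le
    unfolding 1 2 by (rule nn_integral_power_substitution_le[OF k Q])
  show ?ge
    unfolding 1 2 by (rule nn_integral_power_substitution_ge[OF k Q])
qed

section \<open>Forelli--Rudin estimate and the Bergman kernel upstairs\<close>

lemma ball_sets_borel [measurable]: "ball (a :: complex) r \<in> sets borel"
  by simp

lemma one_minus_mult_cnj_nonzero:
  assumes "cmod z \<le> 1" "cmod b < 1"
  shows "1 - z * cnj b \<noteq> 0"
proof
  assume "1 - z * cnj b = 0"
  then have "cmod (z * cnj b) = 1" by simp
  moreover have "cmod z * cmod b \<le> 1 * cmod b"
    using assms by (intro mult_right_mono) auto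
  ultimately show False
    using assms by (simp add: norm_mult)
qed

text \<open>Up to the factor \<open>(1 - |b|^2)^2\<close> the integrand is the Jacobian of the disc
  automorphism that sends \<open>b\<close> to \<open>0\<close>, so the integral measures the area
  \<open>pi\<close> of the disc.\<close>

lemma nn_integral_Forelli_Rudin:
  assumes b: "cmod b < 1"
  shows "(\<integral>\<^sup>+ u\<in>ball 0 1. ennreal (1 / cmod (1 - u * cnj b) ^ 4) \<partial>lborel) = ennreal (pi / (1 - (cmod b)\<^sup>2)\<^sup>2)"
proof -
  let ?f = "Moebius_function 0 b" and ?f' = "\<lambda>z. (1 - b * cnj b) / (1 - z * cnj b)\<^sup>2"
  have f_eq: "?f = (\<lambda>z. (z - b) / (1 - z * cnj b))"
    by (auto simp: Moebius_function_def mult.commute)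
  have der: "(?f has_field_derivative ?f' z) (at z within ball 0 1)" if "z \<in> ball 0 1" for z
    using one_minus_mult_cnj_nonzero[of z b] b that unfolding f_eq
    by (auto intro!: derivative_eq_intros simp: power2_eq_square) (simp add: field_simps)?
  have bij: "bij_betw ?f (ball 0 1) (ball 0 1)"
  proof (rule bij_betw_byWitness[where f' = "Moebius_function 0 (- b)"])
    show "\<forall>z\<in>ball 0 1. Moebius_function 0 (- b) (?f z) = z"
      using b by (auto intro!: Moebius_function_compose)
    show "\<forall>z\<in>ball 0 1. ?f (Moebius_function 0 (- b) z) = z"
      using b by (auto intro!: Moebius_function_compose)
  qed (use b in \<open>auto intro!: Moebius_function_norm_lt_1\<close>)
  have pos: "1 - (cmod b)\<^sup>2 > 0"
    using b by (simp add: abs_square_less_1)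
  have norm_f': "(cmod (?f' z))\<^sup>2 = (1 - (cmod b)\<^sup>2)\<^sup>2 * (1 / cmod (1 - z * cnj b) ^ 4)" for z
  proof -
    have "1 - b * cnj b = of_real (1 - (cmod b)\<^sup>2)"
      by (simp flip: complex_norm_square)
    then have "cmod (1 - b * cnj b) = 1 - (cmod b)\<^sup>2"
      using pos by (simp only: norm_of_real abs_of_pos)
    then show ?thesis
      by (simp add: norm_divide norm_power power_divide flip: power_mult)
  qed
  have "ennreal ((1 - (cmod b)\<^sup>2)\<^sup>2) * (\<integral>\<^sup>+ u\<in>ball 0 1. ennreal (1 / cmod (1 - u * cnj b) ^ 4) \<partial>lborel)
      = (\<integral>\<^sup>+ z\<in>ball 0 1. 1 * ennreal ((cmod (?f' z))\<^sup>2) \<partial>lborel)"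
    unfolding norm_f'
    by (rule trans[OF nn_integral_cmult[symmetric]], measurable, intro nn_integral_cong)
       (simp only: mult_1 ennreal_mult' zero_le_power2 mult.assoc)
  also have "\<dots> = (\<integral>\<^sup>+ z\<in>ball 0 1. 1 \<partial>(lborel :: complex measure))"
    by (rule nn_integral_complex_substitution[OF _ _ _ _ _ der bij]) (auto simp: f_eq)
  also have "\<dots> = ennreal pi"
    by (simp add: emeasure_complex_ball)
  also have "\<dots> = ennreal ((1 - (cmod b)\<^sup>2)\<^sup>2) * ennreal (pi / (1 - (cmod b)\<^sup>2)\<^sup>2)"
    using pos by (subst ennreal_mult[symmetric]) auto
  finally show ?thesis
    using pos by (subst (asm) ennreal_mult_cancel_left) auto
qed

text \<open>Here the kernel is evaluated at \<open>u ^ k\<close> without the Jacobian of the power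
  map. The split at \<open>|u|^k = 1/2\<close> costs \<open>16 = 2^4\<close> for the kernel bound on
  the inner part and \<open>4 = 2^2\<close> for the missing Jacobian on the outer part.\<close>

lemma nn_integral_Forelli_Rudin_power:
  assumes k: "k \<ge> 1" and b: "cmod b < 1"
  shows "(\<integral>\<^sup>+ u\<in>ball 0 1. ennreal (1 / cmod (1 - u ^ k * cnj b) ^ 4) \<partial>lborel)
    \<le> ennreal (20 * pi * real k / (1 - (cmod b)\<^sup>2)\<^sup>2)"
proof -
  let ?w = "\<lambda>u. (cmod (of_nat k * u ^ (k - 1)))\<^sup>2"
  let ?F = "\<lambda>u. ennreal (1 / cmod (1 - u * cnj b) ^ 4) * indicator (ball 0 1) u"
  have pos: "1 - (cmod b)\<^sup>2 > 0"
    using b by (simp add: abs_square_less_1)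
  text \<open>Away from the origin the Jacobian of \<open>u \<mapsto> u ^ k\<close> is bounded below; near it the kernel is bounded.\<close>
  have pt: "1 / cmod (1 - u ^ k * cnj b) ^ 4 \<le> 16 + 4 * (1 / cmod (1 - u ^ k * cnj b) ^ 4 * ?w u)"
    if u: "cmod u < 1" for u
  proof (cases "cmod u ^ k \<le> 1/2")
    case True
    have "cmod (u ^ k * cnj b) \<le> 1/2 * 1"
      unfolding norm_mult norm_power using True b by (intro mult_mono) auto
    then have "1/2 \<le> cmod (1 - u ^ k * cnj b)"
      using norm_triangle_ineq2[of 1 "u ^ k * cnj b"] by simp
    then have "(1/2) ^ 4 \<le> cmod (1 - u ^ k * cnj b) ^ 4"
      by (intro power_mono) auto
    then have "1 / cmod (1 - u ^ k * cnj b) ^ 4 \<le> 1 / (1/2) ^ 4"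
      by (intro divide_left_mono mult_pos_pos) (auto intro: less_le_trans[rotated])
    then show ?thesis
      by (simp add: add_increasing2 power_numeral_reduce)
  next
    case False
    have "cmod u ^ k \<le> cmod u ^ (k - 1)"
      using u by (intro power_decreasing) auto
    also have "\<dots> \<le> real k * cmod u ^ (k - 1)"
      using k by (simp add: mult_le_cancel_right1)
    finally have "1/2 \<le> real k * cmod u ^ (k - 1)"
      using False by simp
    then have "(1/2)\<^sup>2 \<le> ?w u"
      unfolding norm_mult norm_power norm_of_nat by (intro power_mono) auto
    then have "1 / cmod (1 - u ^ k * cnj b) ^ 4 * 1 \<le> 1 / cmod (1 - u ^ k * cnj b) ^ 4 * (4 * ?w u)"
      by (intro mult_left_mono) (auto simp: power2_eq_square)
    then show ?thesis by (simp add: mult_ac)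
  qed
  have split: "ennreal (16 + 4 * (A * w)) = 16 + 4 * (ennreal A * ennreal w)" if "A \<ge> 0" "w \<ge> 0" for A w
    using that by (simp add: ennreal_plus ennreal_mult)
  have split': "16 * ennreal pi + 4 * (of_nat k * ennreal A) = ennreal (16 * pi + 4 * (real k * A))" if "A \<ge> 0" for A
    using that by (simp add: ennreal_plus ennreal_mult ennreal_of_nat_eq_real_of_nat)
  have "(\<integral>\<^sup>+ u\<in>ball 0 1. ennreal (1 / cmod (1 - u ^ k * cnj b) ^ 4) \<partial>lborel)
     \<le> (\<integral>\<^sup>+ u. 16 * indicator (ball 0 1) u + 4 * (?F (u ^ k) * ennreal (?w u)) \<partial>lborel)"
  proof (rule nn_integral_mono)
    fix u
    show "ennreal (1 / cmod (1 - u ^ k * cnj b) ^ 4) * indicator (ball 0 1) u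
        \<le> 16 * indicator (ball 0 1) u + 4 * (?F (u ^ k) * ennreal (?w u))"
    proof (cases "cmod u < 1")
      case True
      have "cmod (u ^ k) < 1"
        using True k by (simp add: norm_power power_less_one_iff)
      let ?A = "1 / cmod (1 - u ^ k * cnj b) ^ 4"
      have "ennreal ?A \<le> ennreal (16 + 4 * (?A * ?w u))"
        by (intro ennreal_leI pt True)
      also have "\<dots> = 16 + 4 * (ennreal ?A * ennreal (?w u))"
        by (rule split) auto
      finally show ?thesis
        using True \<open>cmod (u ^ k) < 1\<close> by simp
    qed auto
  qed
  also have "\<dots> = 16 * emeasure lborel (ball (0::complex) 1) + 4 * (\<integral>\<^sup>+ u. ?F (u ^ k) * ennreal (?w u) \<partial>lborel)"
    by (subst nn_integral_add, measurable) (simp add: nn_integral_cmult)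
  also have "\<dots> \<le> 16 * ennreal pi + 4 * (of_nat k * (\<integral>\<^sup>+ u. ?F u \<partial>lborel))"
    by (intro add_mono mult_left_mono nn_integral_power_substitution_ge k) (auto simp: emeasure_complex_ball)
  also have "\<dots> = 16 * ennreal pi + 4 * (of_nat k * ennreal (pi / (1 - (cmod b)\<^sup>2)\<^sup>2))"
    by (simp only: nn_integral_Forelli_Rudin[OF b])
  also have "\<dots> = ennreal (16 * pi + 4 * (real k * (pi / (1 - (cmod b)\<^sup>2)\<^sup>2)))"
    by (rule split') auto
  also have "\<dots> \<le> ennreal (20 * pi * real k / (1 - (cmod b)\<^sup>2)\<^sup>2)"
  proof (rule ennreal_leI)
    \<comment> \<open>The inner contribution \<open>16 * pi\<close> is absorbed because
      \<open>k / (1 - |b|^2)^2 \<ge> 1\<close>; this gives \<open>20 = 16 + 4\<close>.\<close>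
    have "(1 - (cmod b)\<^sup>2)\<^sup>2 \<le> 1\<^sup>2"
      using pos by (intro power_mono) auto
    then have "1 * 1 \<le> real k * (1 / (1 - (cmod b)\<^sup>2)\<^sup>2)"
      using k pos by (intro mult_mono) (auto simp: divide_simps)
    then have "16 * pi * 1 \<le> 16 * pi * (real k * (1 / (1 - (cmod b)\<^sup>2)\<^sup>2))"
      by (intro mult_left_mono) auto
    then show "16 * pi + 4 * (real k * (pi / (1 - (cmod b)\<^sup>2)\<^sup>2)) \<le> 20 * pi * real k / (1 - (cmod b)\<^sup>2)\<^sup>2"
      using pos by (simp add: divide_simps)
  qed
  finally show ?thesis .
qed

section \<open>Both kernels in the coordinates of the covering\<close>

text \<open>With \<open>s = x * y\<close>, \<open>t = y ^ k\<close> and hence \<open>s ^ k / t = x ^ k\<close>, the numerator of \<open>BergK\<close> divided by \<open>t\<close> is a sum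
  whose \<open>j\<close>-th summand factors: \<open>j\<^sup>2 + (k - j)\<^sup>2 x ^ k y ^ k + j (k - j) (x ^ k + y ^ k) =
  (j + (k - j) x ^ k) (j + (k - j) y ^ k)\<close>.\<close>
definition kernel_num :: "nat \<Rightarrow> complex \<Rightarrow> complex \<Rightarrow> complex" where
  "kernel_num k x y = (\<Sum>j = 1..k. (x * y) ^ (j - 1) * ((of_nat j + of_nat (k - j) * x ^ k) * (of_nat j + of_nat (k - j) * y ^ k)))"

text \<open>The value of \<open>PP\<close> on the diagonal, at the image of \<open>a\<close>.\<close>
definition kernel_diag :: "nat \<Rightarrow> complex \<times> complex \<Rightarrow> real" where
  "kernel_diag k a = 1 / (cmod (snd a) ^ (2 * k) * (1 - cmod (fst a) ^ (2 * k))\<^sup>2 * (1 - cmod (snd a) ^ (2 * k))\<^sup>2)"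

text \<open>The factor \<open>t - s ^ k\<close> becomes \<open>y ^ k * (1 - x ^ k)\<close>, which
  separates the variables. One power \<open>y ^ k\<close> survives in the denominator; its modulus
  is offset by the Jacobian of the covering.\<close>

lemma PP_cover_map:
  assumes "y = snd a * cnj (snd b)" "x = fst a * cnj (fst b)" "y \<noteq> 0"
  shows "PP k (cover_map k a) (cover_map k b) = 1 / (y ^ k * (1 - y ^ k)\<^sup>2 * (1 - x ^ k)\<^sup>2)"
proof -
  have s: "fst (cover_map k a) * cnj (fst (cover_map k b)) = x * y"
    and t: "snd (cover_map k a) * cnj (snd (cover_map k b)) = y ^ k"
    using assms by (simp_all add: cover_map_def power_mult_distrib mult_ac)
  have "y ^ k - (x * y) ^ k = y ^ k * (1 - x ^ k)"
    by (simp add: algebra_simps power_mult_distrib)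
  then show ?thesis
    unfolding PP_def Let_def s t using \<open>y \<noteq> 0\<close>
    by (simp add: power_mult_distrib power2_eq_square)
qed

lemma BergK_cover_map:
  assumes "y = snd a * cnj (snd b)" "x = fst a * cnj (fst b)" "y \<noteq> 0"
  shows "BergK k (cover_map k a) (cover_map k b)
    = kernel_num k x y * PP k (cover_map k a) (cover_map k b) / of_real (real k * pi\<^sup>2)"
proof -
  have s: "fst (cover_map k a) * cnj (fst (cover_map k b)) = x * y"
    and t: "snd (cover_map k a) * cnj (snd (cover_map k b)) = y ^ k"
    using assms by (simp_all add: cover_map_def power_mult_distrib mult_ac)
  \<comment> \<open>The added summand \<open>j = k\<close> carries the factor
    \<open>k - j = 0\<close>; now \<open>pk\<close> and \<open>qk\<close> share their index range
    and can be added termwise.\<close>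
  have pk_eq: "pk k s = (\<Sum>j = 1..k. of_nat (j * (k - j)) * s ^ (j - 1))" for s
    unfolding pk_def by (rule sum.mono_neutral_left) auto
  \<comment> \<open>To be read with \<open>A = j\<close>, \<open>B = k - j\<close>, \<open>s\<close>
    the power with exponent \<open>j - 1\<close>, \<open>X = x ^ k\<close> and
    \<open>Y = y ^ k\<close>, so that \<open>X * Y\<close> is the \<open>k\<close>-th power of the
    original \<open>s\<close>.\<close>
  have alg: "A * B * s * Y\<^sup>2 + (A\<^sup>2 + B\<^sup>2 * (X * Y)) * s * Y + X * Y * (A * B * s)
      = s * ((A + B * X) * (A + B * Y)) * Y" for A B s X Y :: complex
    by (simp add: algebra_simps power2_eq_square)
  have "pk k (x * y) * (y ^ k)\<^sup>2 + qk k (x * y) * y ^ k + (x * y) ^ k * pk k (x * y) = kernel_num k x y * y ^ k"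
    unfolding pk_eq qk_def kernel_num_def sum_distrib_right sum_distrib_left
    unfolding sum.distrib[symmetric]
    by (intro sum.cong refl) (simp only: of_nat_mult of_nat_power power_mult_distrib[of x y k] alg)
  then show ?thesis
    unfolding BergK_def PP_def Let_def s t by (simp add: mult_ac)
qed

text \<open>Each linear factor is at most \<open>j + (k - j) = k\<close>, and there are
  \<open>k\<close> summands.\<close>

lemma kernel_num_norm_le:
  assumes "cmod x \<le> 1" "cmod y \<le> 1"
  shows "cmod (kernel_num k x y) \<le> real k ^ 3"
proof -
  have fac: "cmod (of_nat j + of_nat (k - j) * u ^ k) \<le> real k" if "j \<le> k" "cmod u \<le> 1" for j u
  proof -
    have "cmod (of_nat j + of_nat (k - j) * u ^ k) \<le> real j + real (k - j) * cmod u ^ k"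
      by (rule order_trans[OF norm_triangle_ineq]) (simp add: norm_mult norm_power)
    also have "\<dots> \<le> real j + real (k - j) * 1"
      using that by (intro add_left_mono mult_left_mono power_le_one) auto
    finally show ?thesis
      using that by (simp add: of_nat_diff)
  qed
  have "cmod (kernel_num k x y) \<le> (\<Sum>j = 1..k. 1 * (real k * real k))"
    unfolding kernel_num_def
  proof (rule order_trans[OF norm_sum sum_mono])
    fix j assume "j \<in> {1..k}"
    then have "j \<le> k" by simp
    show "cmod ((x * y) ^ (j - 1) * ((of_nat j + of_nat (k - j) * x ^ k) * (of_nat j + of_nat (k - j) * y ^ k)))
        \<le> 1 * (real k * real k)"
      unfolding norm_mult norm_power using assms
      by (intro mult_mono power_le_one fac \<open>j \<le> k\<close> mult_le_one) (auto intro!: mult_nonneg_nonneg)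
  qed
  then show ?thesis
    by (simp add: power3_eq_cube mult_ac)
qed

text \<open>This is the situation on the diagonal. All summands are nonnegative, and the one for
  \<open>j = 1\<close> is at least \<open>1\<close>.\<close>

lemma kernel_num_of_real:
  assumes "k \<ge> 1" "r \<ge> 0" "q \<ge> 0"
  obtains n where "kernel_num k (of_real r) (of_real q) = of_real n" "n \<ge> 1"
proof
  let ?g = "\<lambda>j. (r * q) ^ (j - 1) * ((real j + real (k - j) * r ^ k) * (real j + real (k - j) * q ^ k))"
  show "kernel_num k (of_real r) (of_real q) = of_real (\<Sum>j = 1..k. ?g j)"
    by (simp add: kernel_num_def)
  have "1 * 1 \<le> (1 + real (k - 1) * r ^ k) * (1 + real (k - 1) * q ^ k)"
    using assms by (intro mult_mono) auto
  then have "1 \<le> ?g 1" by simp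
  also have "\<dots> \<le> (\<Sum>j = 1..k. ?g j)"
    using assms by (intro member_le_sum) (auto intro!: mult_nonneg_nonneg add_nonneg_nonneg)
  finally show "1 \<le> (\<Sum>j = 1..k. ?g j)" .
qed

lemma cover_dom_pos:
  assumes "a \<in> cover_dom" "k \<ge> 1"
  shows "cmod (snd a) > 0" "cmod (snd a) < 1" "cmod (fst a) < 1"
    "1 - cmod (fst a) ^ (2 * k) > 0" "1 - cmod (snd a) ^ (2 * k) > 0"
  using assms by (auto simp: cover_dom_def power_less_one_iff)

lemma kernel_diag_pos:
  assumes "a \<in> cover_dom" "k \<ge> 1"
  shows "kernel_diag k a > 0"
  using cover_dom_pos[OF assms] by (simp add: kernel_diag_def)

text \<open>On the diagonal the numerator lies between \<open>1\<close> and \<open>k^3\<close>;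
  dividing by \<open>k * pi^2\<close> gives both constants. Normalising by \<open>BergK\<close> or
  by the diagonal of \<open>PP\<close> thus amounts to the same up to constants.\<close>

lemma BergK_diag_bounds:
  assumes a: "a \<in> cover_dom" and k: "k \<ge> 1"
  shows "kernel_diag k a / (real k * pi\<^sup>2) \<le> Re (BergK k (cover_map k a) (cover_map k a))"
    and "Re (BergK k (cover_map k a) (cover_map k a)) \<le> real k ^ 2 / pi\<^sup>2 * kernel_diag k a"
proof -
  note pos = cover_dom_pos[OF a k]
  have xy: "of_real ((cmod (snd a))\<^sup>2) = snd a * cnj (snd a)" "of_real ((cmod (fst a))\<^sup>2) = fst a * cnj (fst a)"
    "complex_of_real ((cmod (snd a))\<^sup>2) \<noteq> 0"
    using pos by (auto simp flip: complex_norm_square)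
  have P: "PP k (cover_map k a) (cover_map k a) = of_real (kernel_diag k a)"
    unfolding PP_cover_map[OF xy] kernel_diag_def by (simp add: power_mult mult_ac flip: power_mult)
  obtain n where n: "kernel_num k (of_real ((cmod (fst a))\<^sup>2)) (of_real ((cmod (snd a))\<^sup>2)) = of_real n" "n \<ge> 1"
    using kernel_num_of_real[OF k, of "(cmod (fst a))\<^sup>2" "(cmod (snd a))\<^sup>2"] by auto
  have "cmod (of_real n) \<le> real k ^ 3"
    unfolding n(1)[symmetric] using pos by (intro kernel_num_norm_le) (auto simp: norm_power power_le_one)
  then have n3: "n \<le> real k ^ 3"
    using n(2) by simp
  have "BergK k (cover_map k a) (cover_map k a) = of_real (n * kernel_diag k a / (real k * pi\<^sup>2))"
    unfolding BergK_cover_map[OF xy] n(1) P by simp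
  then have B: "Re (BergK k (cover_map k a) (cover_map k a)) = n * kernel_diag k a / (real k * pi\<^sup>2)"
    by (simp only: Re_complex_of_real)
  have d: "kernel_diag k a > 0"
    by (rule kernel_diag_pos[OF a k])
  show "kernel_diag k a / (real k * pi\<^sup>2) \<le> Re (BergK k (cover_map k a) (cover_map k a))"
    unfolding B using n(2) d k by (intro divide_right_mono) auto
  have "n * kernel_diag k a \<le> real k ^ 3 * kernel_diag k a"
    using n3 d by (intro mult_right_mono) auto
  then show "Re (BergK k (cover_map k a) (cover_map k a)) \<le> real k ^ 2 / pi\<^sup>2 * kernel_diag k a"
    unfolding B using k by (simp add: divide_simps power3_eq_cube power2_eq_square mult_ac)
qed

section \<open>Norm and pointwise bounds for the kernels\<close>

lemma cnj_borel [measurable]: "cnj \<in> borel_measurable borel"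
  by (intro borel_measurable_continuous_onI continuous_intros)

lemma borel_measurable_PP [measurable]:
  assumes f: "f \<in> borel_measurable M" and g: "g \<in> borel_measurable M"
  shows "(\<lambda>x. PP k (f x) (g x)) \<in> borel_measurable M"
proof -
  note [measurable] = measurable_compose[OF f fst_borel] measurable_compose[OF f snd_borel]
    measurable_compose[OF g fst_borel] measurable_compose[OF g snd_borel]
  show ?thesis
    unfolding PP_def Let_def by measurable
qed

lemma borel_measurable_BergK [measurable]:
  assumes f: "f \<in> borel_measurable M" and g: "g \<in> borel_measurable M"
  shows "(\<lambda>x. BergK k (f x) (g x)) \<in> borel_measurable M"
proof -
  note [measurable] = measurable_compose[OF f fst_borel] measurable_compose[OF f snd_borel]
    measurable_compose[OF g fst_borel] measurable_compose[OF g snd_borel]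
  show ?thesis
    unfolding BergK_def pk_def qk_def Let_def by measurable
qed

definition cover_lift :: "nat \<Rightarrow> complex \<times> complex \<Rightarrow> complex \<times> complex" where
  "cover_lift k z = (fst z / croot k (snd z), croot k (snd z))"

lemma
  assumes k: "k \<ge> 1" and z: "z \<in> Hk k"
  shows cover_map_lift: "cover_map k (cover_lift k z) = z"
    and cover_lift_in_dom: "cover_lift k z \<in> cover_dom"
proof -
  have "snd z \<noteq> 0"
    using z by (auto simp: Hk_def not_less)
  then have pow: "croot k (snd z) ^ k = snd z"
    using k by (rule croot_power[rotated])
  show "cover_map k (cover_lift k z) = z"
    by (simp add: cover_map_def cover_lift_def pow prod_eq_iff)
  have n: "cmod (croot k (snd z)) ^ k = cmod (snd z)"
    by (metis norm_power pow)
  have "cmod (fst z) ^ k < cmod (croot k (snd z)) ^ k"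
    unfolding n using z by (simp add: Hk_def)
  then have "cmod (fst z) < cmod (croot k (snd z))"
    by (rule power_less_imp_less_base) simp
  moreover have "cmod (croot k (snd z)) < 1"
    using z n k by (auto simp: Hk_def power_less_one_iff dest!: sym[of _ "cmod (snd z)"])
  ultimately show "cover_lift k z \<in> cover_dom"
    by (simp add: cover_lift_def cover_dom_def norm_divide)
qed

lemma norm_PP_square:
  assumes "b \<in> cover_dom" "a \<in> cover_dom"
  shows "(cmod (PP k (cover_map k a) (cover_map k b)))\<^sup>2 = 1 / (cmod (snd a) ^ (2 * k) * cmod (snd b) ^ (2 * k)
    * cmod (1 - (snd a * cnj (snd b)) ^ k) ^ 4 * cmod (1 - (fst a * cnj (fst b)) ^ k) ^ 4)"
proof -
  have "snd a * cnj (snd b) \<noteq> 0"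
    using assms by (auto simp: cover_dom_def)
  from PP_cover_map[OF refl refl this, of k] show ?thesis
    by (simp add: norm_divide norm_mult norm_power power_divide power_mult_distrib mult_ac flip: power_mult)
qed

text \<open>The Jacobian cancels the power of \<open>|snd a|\<close> in the squared kernel, so the
  integral splits into two disc integrals of Forelli--Rudin type. The constant is \<open>k^2\<close>
  from the Jacobian times \<open>(20 * pi * k)^2\<close>.\<close>

lemma nn_integral_PP_le:
  assumes k: "k \<ge> 1" and b: "b \<in> cover_dom"
  shows "(\<integral>\<^sup>+ z\<in>Hk k. ennreal ((cmod (PP k z (cover_map k b)))\<^sup>2) \<partial>lborel)
    \<le> ennreal ((20 * pi * (real k)\<^sup>2)\<^sup>2 * kernel_diag k b)"
proof -
  note pos = cover_dom_pos[OF b k]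
  let ?A = "\<lambda>q u. ennreal (1 / cmod (1 - u ^ k * cnj (q ^ k)) ^ 4) * indicator (ball 0 1) u"
  let ?c = "(real k)\<^sup>2 / cmod (snd b) ^ (2 * k)"
  have prod3: "ennreal (C * (A * B)) = ennreal C * (ennreal A * ennreal B)" if "C \<ge> 0" "A \<ge> 0" "B \<ge> 0" for A B C
    using that by (simp add: ennreal_mult)
  have int_le: "(\<integral>\<^sup>+ u. ?A q u \<partial>lborel) \<le> ennreal (20 * pi * real k / (1 - cmod q ^ (2 * k))\<^sup>2)" if "cmod q < 1" for q
  proof -
    have "cmod (q ^ k) < 1"
      using that k by (simp add: norm_power power_less_one_iff)
    from nn_integral_Forelli_Rudin_power[OF k this] show ?thesis
      by (simp add: norm_power mult.commute flip: power_mult)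
  qed
  have [measurable]: "?A q \<in> borel_measurable borel" for q
    by measurable
  have [measurable]: "(\<lambda>z. ennreal ((cmod (PP k z (cover_map k b)))\<^sup>2)) \<in> borel_measurable borel"
    by measurable
  have m: "(\<lambda>a. ?A (snd b) (snd a) * ?A (fst b) (fst a)) \<in> borel_measurable borel"
    by measurable
  have "(\<integral>\<^sup>+ z\<in>Hk k. ennreal ((cmod (PP k z (cover_map k b)))\<^sup>2) \<partial>lborel)
     \<le> (\<integral>\<^sup>+ a\<in>cover_dom. ennreal ((cmod (PP k (cover_map k a) (cover_map k b)))\<^sup>2)
          * ennreal ((real k)\<^sup>2 * cmod (snd a) ^ (2 * k)) \<partial>lborel)"
    by (rule nn_integral_Hk_le_cover[OF k]) measurable
  \<comment> \<open>The puncture is filled in, so that the domain is a full bidisc with a product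
    indicator.\<close>
  also have "\<dots> \<le> (\<integral>\<^sup>+ a. ennreal ?c * (?A (snd b) (snd a) * ?A (fst b) (fst a)) \<partial>lborel)"
  proof (rule nn_integral_mono)
    fix a :: "complex \<times> complex"
    show "ennreal ((cmod (PP k (cover_map k a) (cover_map k b)))\<^sup>2) * ennreal ((real k)\<^sup>2 * cmod (snd a) ^ (2 * k)) * indicator cover_dom a
        \<le> ennreal ?c * (?A (snd b) (snd a) * ?A (fst b) (fst a))"
    proof (cases "a \<in> cover_dom")
      case True
      have "ennreal ((cmod (PP k (cover_map k a) (cover_map k b)))\<^sup>2) * ennreal ((real k)\<^sup>2 * cmod (snd a) ^ (2 * k))
          = ennreal ((cmod (PP k (cover_map k a) (cover_map k b)))\<^sup>2 * ((real k)\<^sup>2 * cmod (snd a) ^ (2 * k)))"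
        by (rule ennreal_mult'[symmetric]) simp
      also have "(cmod (PP k (cover_map k a) (cover_map k b)))\<^sup>2 * ((real k)\<^sup>2 * cmod (snd a) ^ (2 * k))
          = ?c * ((1 / cmod (1 - snd a ^ k * cnj (snd b ^ k)) ^ 4) * (1 / cmod (1 - fst a ^ k * cnj (fst b ^ k)) ^ 4))"
        unfolding norm_PP_square[OF b True] complex_cnj_power power_mult_distrib[of "snd a" "cnj (snd b)", symmetric]
          power_mult_distrib[of "fst a" "cnj (fst b)", symmetric]
        using cover_dom_pos(1)[OF True k] by simp
      also have "ennreal \<dots> = ennreal ?c * (ennreal (1 / cmod (1 - snd a ^ k * cnj (snd b ^ k)) ^ 4)
          * ennreal (1 / cmod (1 - fst a ^ k * cnj (fst b ^ k)) ^ 4))"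
        by (rule prod3) auto
      finally have eq: "ennreal ((cmod (PP k (cover_map k a) (cover_map k b)))\<^sup>2) * ennreal ((real k)\<^sup>2 * cmod (snd a) ^ (2 * k))
          = ennreal ?c * (ennreal (1 / cmod (1 - snd a ^ k * cnj (snd b ^ k)) ^ 4)
          * ennreal (1 / cmod (1 - fst a ^ k * cnj (fst b ^ k)) ^ 4))" .
      have "fst a \<in> ball 0 1" "snd a \<in> ball 0 1"
        using cover_dom_pos[OF True k] by auto
      with True show ?thesis
        unfolding eq by (simp only: indicator_simps mult_1_right order_refl)
    qed simp
  qed
  also have "(\<integral>\<^sup>+ a. ennreal ?c * (?A (snd b) (snd a) * ?A (fst b) (fst a)) \<partial>lborel) = ennreal ?c * ((\<integral>\<^sup>+ u. ?A (snd b) u \<partial>lborel) * (\<integral>\<^sup>+ u. ?A (fst b) u \<partial>lborel))"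
  proof -
    have "(\<integral>\<^sup>+ a. ?A (snd b) (snd a) * ?A (fst b) (fst a) \<partial>lborel) =
        (\<integral>\<^sup>+ y. (\<integral>\<^sup>+ x. ?A (snd b) y * ?A (fst b) x \<partial>lborel) \<partial>lborel)"
      using nn_integral_complex_pair[OF m] by simp
    also have "\<dots> = (\<integral>\<^sup>+ y. ?A (snd b) y * (\<integral>\<^sup>+ x. ?A (fst b) x \<partial>lborel) \<partial>lborel)"
      by (intro nn_integral_cong nn_integral_cmult) measurable
    also have "\<dots> = (\<integral>\<^sup>+ u. ?A (snd b) u \<partial>lborel) * (\<integral>\<^sup>+ u. ?A (fst b) u \<partial>lborel)"
      by (intro nn_integral_multc) measurable
    finally have eq: "(\<integral>\<^sup>+ a. ?A (snd b) (snd a) * ?A (fst b) (fst a) \<partial>lborel)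
        = (\<integral>\<^sup>+ u. ?A (snd b) u \<partial>lborel) * (\<integral>\<^sup>+ u. ?A (fst b) u \<partial>lborel)" .
    have "(\<lambda>a. ?A (snd b) (snd a) * ?A (fst b) (fst a)) \<in> borel_measurable lborel"
      using m by simp
    from nn_integral_cmult[OF this] show ?thesis
      unfolding eq by (rule trans) (rule refl)
  qed
  also have "\<dots> \<le> ennreal ?c * (ennreal (20 * pi * real k / (1 - cmod (snd b) ^ (2 * k))\<^sup>2)
      * ennreal (20 * pi * real k / (1 - cmod (fst b) ^ (2 * k))\<^sup>2))"
    using pos by (intro mult_left_mono mult_mono int_le) auto
  also have "\<dots> = ennreal (?c * (20 * pi * real k / (1 - cmod (snd b) ^ (2 * k))\<^sup>2
      * (20 * pi * real k / (1 - cmod (fst b) ^ (2 * k))\<^sup>2)))"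
    by (rule prod3[symmetric]) auto
  also have "?c * (20 * pi * real k / (1 - cmod (snd b) ^ (2 * k))\<^sup>2
      * (20 * pi * real k / (1 - cmod (fst b) ^ (2 * k))\<^sup>2)) = (20 * pi * (real k)\<^sup>2)\<^sup>2 * kernel_diag k b"
    by (simp add: kernel_diag_def power2_eq_square mult_ac)
  finally show ?thesis .
qed

lemma norm_BergK_le:
  assumes "k \<ge> 1" "a \<in> cover_dom" "b \<in> cover_dom"
  shows "cmod (BergK k (cover_map k a) (cover_map k b)) \<le> (real k)\<^sup>2 / pi\<^sup>2 * cmod (PP k (cover_map k a) (cover_map k b))"
proof -
  have nz: "snd a * cnj (snd b) \<noteq> 0"
    using assms by (auto simp: cover_dom_def)
  have "cmod (fst a * cnj (fst b)) \<le> 1" "cmod (snd a * cnj (snd b)) \<le> 1"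
    using assms by (auto simp: cover_dom_def norm_mult intro!: mult_le_one)
  then have "cmod (kernel_num k (fst a * cnj (fst b)) (snd a * cnj (snd b))) \<le> real k ^ 3"
    by (rule kernel_num_norm_le)
  then have "cmod (kernel_num k (fst a * cnj (fst b)) (snd a * cnj (snd b))) * cmod (PP k (cover_map k a) (cover_map k b))
      / (real k * pi\<^sup>2) \<le> real k ^ 3 * cmod (PP k (cover_map k a) (cover_map k b)) / (real k * pi\<^sup>2)"
    by (intro divide_right_mono mult_right_mono) auto
  also have "\<dots> = (real k)\<^sup>2 / pi\<^sup>2 * cmod (PP k (cover_map k a) (cover_map k b))"
    using assms(1) by (simp add: power3_eq_cube power2_eq_square)
  finally show ?thesis
    unfolding BergK_cover_map[OF refl refl nz] by (simp add: norm_divide norm_mult norm_power)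
qed

text \<open>Pseudohyperbolic neighbourhoods of \<open>a\<close>, up to comparison of constants.\<close>
definition near :: "real \<Rightarrow> complex \<times> complex \<Rightarrow> complex \<times> complex \<Rightarrow> bool" where
  "near c a b \<longleftrightarrow> dist (fst a) (fst b) < c * (1 - cmod (fst a)) \<and> dist (snd a) (snd b) < c * (1 - cmod (snd a))"

text \<open>Up to \<open>pi^2 * c^4\<close>, the reciprocal of the volume of the neighbourhood
  \<open>near c a\<close> times \<open>|snd a|^(2k)\<close>: the constant that the sub-mean value
  inequality produces.\<close>

definition local_weight :: "nat \<Rightarrow> complex \<times> complex \<Rightarrow> real" where
  "local_weight k a = 1 / (cmod (snd a) ^ (2 * k) * (1 - cmod (fst a))\<^sup>2 * (1 - cmod (snd a))\<^sup>2)"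

text \<open>With \<open>r = 1 - |p|\<close>, a nearby \<open>q\<close> satisfies
  \<open>1 - |q| \<ge> r/2\<close>, while \<open>|1 - (p * cnj q) ^ k|\<close> is at most
  \<open>3 * k * r\<close>. The bounds appear with exponents \<open>2\<close> and \<open>4\<close>,
  whence \<open>4\<close> and \<open>(3 * k)^4\<close>.\<close>

lemma disc_kernel_lower:
  assumes k: "k \<ge> 1" and p: "cmod p < 1" and q: "cmod q < 1"
    and near: "dist p q < c * (1 - cmod p)" and c: "c \<le> 1/2"
  shows "1 / (1 - cmod p)\<^sup>2 \<le> 4 * (3 * real k) ^ 4 * ((1 - cmod q ^ (2 * k))\<^sup>2 / cmod (1 - (p * cnj q) ^ k) ^ 4)"
proof -
  define r where "r = 1 - cmod p"
  define u where "u = cmod (1 - (p * cnj q) ^ k)"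
  define d where "d = 1 - cmod q ^ (2 * k)"
  have r: "r > 0" using p by (simp add: r_def)
  have "c * r \<le> r / 2"
    using mult_right_mono[OF c, of r] r by simp
  with near have pq: "dist p q < r / 2"
    unfolding r_def by linarith
  have "cmod q \<le> cmod p + dist p q"
    using norm_triangle_ineq2[of q p] by (simp add: dist_norm norm_minus_commute)
  then have "1 - cmod q \<ge> r / 2"
    using pq r_def by (simp add: field_simps)
  moreover have "cmod q ^ (2 * k) \<le> cmod q"
    using q k power_decreasing[of 1 "2 * k" "cmod q"] by simp
  ultimately have d: "d \<ge> r / 2"
    unfolding d_def by linarith
  have pq1: "cmod (p * cnj q) < 1"
    using norm_mult_less[of p 1 "cnj q" 1] p q by simp
  \<comment> \<open>Splits off the diagonal value, at most \<open>2 * r\<close>; the remainder is at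
    most \<open>|p - q| < r/2\<close>.\<close>
  have "1 - p * cnj q = (1 - p * cnj p) + p * cnj (p - q)"
    by (simp add: algebra_simps)
  also have "cmod \<dots> \<le> cmod (1 - p * cnj p) + cmod (p * cnj (p - q))"
    by (rule norm_triangle_ineq)
  also have "cmod (p * cnj (p - q)) = cmod p * cmod (p - q)"
    by (simp only: norm_mult complex_mod_cnj)
  finally have tri: "cmod (1 - p * cnj q) \<le> cmod (1 - p * cnj p) + cmod p * cmod (p - q)" .
  have nonneg: "(1 + cmod p) * r \<ge> 0"
    using r by simp
  have "1 - p * cnj p = of_real (1 - (cmod p)\<^sup>2)"
    by (simp flip: complex_norm_square)
  also have "1 - (cmod p)\<^sup>2 = (1 + cmod p) * r"
    by (simp add: r_def power2_eq_square algebra_simps)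
  finally have "cmod (1 - p * cnj p) = (1 + cmod p) * r"
    using nonneg by (simp only: norm_of_real abs_of_nonneg)
  moreover have "(1 + cmod p) * r \<le> 2 * r"
    using p r by (intro mult_right_mono) auto
  moreover have "cmod p * cmod (p - q) \<le> 1 * (r / 2)"
    using p pq by (intro mult_mono) (auto simp: dist_norm)
  ultimately have *: "cmod (1 - p * cnj q) \<le> 3 * r"
    using tri r by linarith
  \<comment> \<open>The power map is \<open>k\<close>-Lipschitz on the closed unit disc.\<close>
  have "cmod (1 ^ k - (p * cnj q) ^ k) \<le> real k * cmod (1 - p * cnj q)"
    using pq1 by (intro norm_power_diff) auto
  also have "\<dots> \<le> real k * (3 * r)"
    using * by (intro mult_left_mono) auto
  finally have u: "u \<le> 3 * real k * r"
    by (simp add: u_def mult_ac)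
  have "v ^ k < 1" if "0 \<le> v" "v < 1" for v :: real
    using that k by (simp add: power_less_one_iff)
  then have "cmod ((p * cnj q) ^ k) < 1"
    unfolding norm_power using pq1 by (metis norm_ge_zero)
  then have u0: "u > 0"
    unfolding u_def by (metis norm_one less_irrefl right_minus_eq zero_less_norm_iff)
  have "u ^ 4 \<le> (3 * real k * r) ^ 4"
    using u u0 by (intro power_mono) auto
  moreover have "(r / 2)\<^sup>2 \<le> d\<^sup>2"
    using d r by (intro power_mono) auto
  ultimately have "(r / 2)\<^sup>2 * u ^ 4 \<le> d\<^sup>2 * (3 * real k * r) ^ 4"
    using u0 by (intro mult_mono) auto
  moreover define N where "N = (3 * real k) ^ 4"
  moreover have "(3 * real k * r) ^ 4 = N * (r\<^sup>2 * r\<^sup>2)"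
    unfolding N_def power_mult_distrib by (simp flip: power_add)
  ultimately have "r\<^sup>2 * u ^ 4 \<le> r\<^sup>2 * (4 * N * d\<^sup>2 * r\<^sup>2)"
    by (simp add: power_divide mult_ac)
  then have "u ^ 4 \<le> 4 * N * d\<^sup>2 * r\<^sup>2"
    using r by (simp add: mult_le_cancel_left_pos)
  then have "1 / r\<^sup>2 \<le> 4 * N * (d\<^sup>2 / u ^ 4)"
    using r u0 by (simp add: divide_simps mult_ac)
  then show ?thesis
    by (simp only: r_def u_def d_def N_def)
qed

text \<open>The disc estimate in each coordinate; the power of \<open>|snd b|\<close> cancels
  between the squared kernel and \<open>kernel_diag\<close>.\<close>

lemma PP_lower:
  assumes k: "k \<ge> 1" and a: "a \<in> cover_dom" and b: "b \<in> cover_dom" and near: "near c a b" and c: "c \<le> 1/2"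
  shows "local_weight k a \<le> (4 * (3 * real k) ^ 4)\<^sup>2 * ((cmod (PP k (cover_map k a) (cover_map k b)))\<^sup>2 / kernel_diag k b)"
proof -
  note pa = cover_dom_pos[OF a k] and pb = cover_dom_pos[OF b k]
  define M where "M = 4 * (3 * real k) ^ 4"
  let ?g = "\<lambda>p q. (1 - cmod q ^ (2 * k))\<^sup>2 / cmod (1 - (p * cnj q) ^ k) ^ 4"
  have 1: "1 / (1 - cmod (fst a))\<^sup>2 \<le> M * ?g (fst a) (fst b)"
    using near pa pb unfolding M_def by (intro disc_kernel_lower[OF k _ _ _ c]) (auto simp: near_def)
  have 2: "1 / (1 - cmod (snd a))\<^sup>2 \<le> M * ?g (snd a) (snd b)"
    using near pa pb unfolding M_def by (intro disc_kernel_lower[OF k _ _ _ c]) (auto simp: near_def)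
  have "local_weight k a = 1 / cmod (snd a) ^ (2 * k) * (1 / (1 - cmod (fst a))\<^sup>2 * (1 / (1 - cmod (snd a))\<^sup>2))"
    by (simp add: local_weight_def)
  also have "\<dots> \<le> 1 / cmod (snd a) ^ (2 * k) * ((M * ?g (fst a) (fst b)) * (M * ?g (snd a) (snd b)))"
    using pa by (intro mult_left_mono mult_mono 1 2) (auto simp: M_def)
  also have "\<dots> = M\<^sup>2 * (1 / cmod (snd a) ^ (2 * k) * ?g (fst a) (fst b) * ?g (snd a) (snd b))"
    by (simp add: power2_eq_square mult_ac)
  also have "1 / cmod (snd a) ^ (2 * k) * ?g (fst a) (fst b) * ?g (snd a) (snd b)
      = (cmod (PP k (cover_map k a) (cover_map k b)))\<^sup>2 / kernel_diag k b"
    unfolding norm_PP_square[OF b a] kernel_diag_def using pb by (simp add: mult_ac)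
  finally show ?thesis unfolding M_def .
qed

text \<open>On the diagonal the numerator is at least \<open>1\<close>. As a polynomial it is
  uniformly continuous on the closed bidisc, so it stays above \<open>1/2\<close> within one
  distance \<open>d\<close> of the diagonal values, right up to the boundary.\<close>

lemma kernel_num_lower:
  assumes k: "k \<ge> 1"
  obtains c where "c > 0" "c \<le> 1/2"
    "\<And>a b. a \<in> cover_dom \<Longrightarrow> b \<in> cover_dom \<Longrightarrow> near c a b \<Longrightarrow>
      cmod (kernel_num k (fst a * cnj (fst b)) (snd a * cnj (snd b))) \<ge> 1/2"
proof -
  let ?f = "\<lambda>p. kernel_num k (fst p) (snd p)" and ?K = "cball 0 1 \<times> cball (0::complex) 1 :: (complex \<times> complex) set"
  have "uniformly_continuous_on ?K ?f"
    unfolding kernel_num_def by (intro compact_uniformly_continuous continuous_intros compact_Times) auto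
  then obtain d where d: "d > 0" "\<And>p p'. p \<in> ?K \<Longrightarrow> p' \<in> ?K \<Longrightarrow> dist p' p < d \<Longrightarrow> dist (?f p') (?f p) < 1/2"
    unfolding uniformly_continuous_on_def by (meson half_gt_zero zero_less_one)
  \<comment> \<open>Each coordinate moves by less than \<open>c\<close>, hence \<open>d/2\<close>;
    the bound \<open>1/2\<close> is the one that \<open>disc_kernel_lower\<close> asks for.\<close>
  define c where "c = min (1/2) (d/2)"
  show ?thesis
  proof (rule that)
    show "c > 0" "c \<le> 1/2"
      using d by (auto simp: c_def)
    fix a b assume a: "a \<in> cover_dom" and b: "b \<in> cover_dom" and near: "near c a b"
    let ?p = "(of_real ((cmod (fst a))\<^sup>2), of_real ((cmod (snd a))\<^sup>2)) :: complex \<times> complex"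
    let ?q = "(fst a * cnj (fst b), snd a * cnj (snd b))"
    have disc: "dist (u * cnj v) (of_real ((cmod u)\<^sup>2)) < c" if "dist u v < c * (1 - cmod u)" "cmod u < 1" for u v
    proof -
      have "u * cnj v - of_real ((cmod u)\<^sup>2) = u * cnj (v - u)"
        by (simp add: algebra_simps flip: complex_norm_square)
      then have "dist (u * cnj v) (of_real ((cmod u)\<^sup>2)) = cmod u * dist u v"
        by (simp add: dist_norm norm_mult norm_minus_commute flip: complex_cnj_diff)
      also have "\<dots> \<le> 1 * dist u v"
        using that by (intro mult_right_mono) auto
      also have "\<dots> < c * (1 - cmod u)"
        using that by simp
      also have "\<dots> \<le> c * 1"
        using \<open>c > 0\<close> by (intro mult_left_mono) auto
      finally show ?thesis by simp
    qed
    have "dist ?q ?p \<le> dist (fst ?q) (fst ?p) + dist (snd ?q) (snd ?p)"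
      unfolding dist_Pair_Pair fst_conv snd_conv by (rule sqrt_sum_squares_le_sum) auto
    also have "\<dots> < c + c"
      using near a unfolding near_def cover_dom_def fst_conv snd_conv
      by (intro add_strict_mono disc) auto
    also have "\<dots> \<le> d"
      by (simp add: c_def)
    finally have "dist (?f ?q) (?f ?p) < 1/2"
      using a b by (intro d) (auto simp: cover_dom_def norm_mult norm_power power_le_one intro!: mult_le_one)
    moreover obtain n where "?f ?p = of_real n" "n \<ge> 1"
      using kernel_num_of_real[OF k, of "(cmod (fst a))\<^sup>2" "(cmod (snd a))\<^sup>2"] by auto
    moreover have "cmod (?f ?p) \<le> cmod (?f ?q) + dist (?f ?q) (?f ?p)"
      using norm_triangle_ineq2[of "?f ?p" "?f ?q"] by (simp add: dist_norm norm_minus_commute)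
    ultimately show "cmod (kernel_num k (fst a * cnj (fst b)) (snd a * cnj (snd b))) \<ge> 1/2"
      by simp
  qed
qed

section \<open>Holomorphic functions on the Hartogs triangle\<close>

definition holomorphic2_at :: "(complex \<times> complex \<Rightarrow> complex) \<Rightarrow> complex \<times> complex \<Rightarrow> bool" where
  "holomorphic2_at f z \<longleftrightarrow> (\<exists>a b. (f has_derivative (\<lambda>h. a * fst h + b * snd h)) (at z))"

lemma holomorphic2_on_iff_at: "holomorphic2_on f U \<longleftrightarrow> (\<forall>z\<in>U. holomorphic2_at f z)"
  by (simp add: holomorphic2_on_def holomorphic2_at_def)

lemma holomorphic2_at_const: "holomorphic2_at (\<lambda>_. c) z"
  unfolding holomorphic2_at_def by (intro exI[of _ 0]) simp

lemma holomorphic2_at_fst: "holomorphic2_at fst z"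
  unfolding holomorphic2_at_def by (intro exI[of _ 1] exI[of _ 0]) (simp add: has_derivative_fst)

lemma holomorphic2_at_snd: "holomorphic2_at snd z"
  unfolding holomorphic2_at_def by (intro exI[of _ 0] exI[of _ 1]) (simp add: has_derivative_snd)

lemma holomorphic2_at_add:
  assumes "holomorphic2_at f z" "holomorphic2_at g z"
  shows "holomorphic2_at (\<lambda>z. f z + g z) z"
proof -
  obtain a b c d where "(f has_derivative (\<lambda>h. a * fst h + b * snd h)) (at z)"
    "(g has_derivative (\<lambda>h. c * fst h + d * snd h)) (at z)"
    using assms unfolding holomorphic2_at_def by blast
  from has_derivative_add[OF this] show ?thesis
    unfolding holomorphic2_at_def by (intro exI[of _ "a + c"] exI[of _ "b + d"]) (simp add: algebra_simps)
qed

lemma holomorphic2_at_mult: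
  assumes "holomorphic2_at f z" "holomorphic2_at g z"
  shows "holomorphic2_at (\<lambda>z. f z * g z) z"
proof -
  obtain a b c d where "(f has_derivative (\<lambda>h. a * fst h + b * snd h)) (at z)"
    "(g has_derivative (\<lambda>h. c * fst h + d * snd h)) (at z)"
    using assms unfolding holomorphic2_at_def by blast
  from has_derivative_mult[OF this] show ?thesis
    unfolding holomorphic2_at_def
    by (intro exI[of _ "f z * c + a * g z"] exI[of _ "f z * d + b * g z"]) (simp add: algebra_simps)
qed

lemma holomorphic2_at_compose:
  assumes "holomorphic2_at f z" "(\<phi> has_field_derivative d) (at (f z))"
  shows "holomorphic2_at (\<lambda>z. \<phi> (f z)) z"
proof -
  obtain a b where "(f has_derivative (\<lambda>h. a * fst h + b * snd h)) (at z)"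
    using assms unfolding holomorphic2_at_def by blast
  from has_derivative_compose[OF this assms(2)[unfolded has_field_derivative_def]] show ?thesis
    unfolding holomorphic2_at_def by (intro exI[of _ "d * a"] exI[of _ "d * b"]) (simp add: algebra_simps)
qed

lemma holomorphic2_at_power: "holomorphic2_at f z \<Longrightarrow> holomorphic2_at (\<lambda>z. f z ^ n) z"
  by (rule holomorphic2_at_compose[where \<phi> = "\<lambda>x. x ^ n"]) (auto intro!: derivative_eq_intros)

lemma holomorphic2_at_diff:
  assumes "holomorphic2_at f z" "holomorphic2_at g z"
  shows "holomorphic2_at (\<lambda>z. f z - g z) z"
  using holomorphic2_at_add[OF assms(1) holomorphic2_at_mult[OF holomorphic2_at_const[of "-1"] assms(2)]] by simp

lemma holomorphic2_at_divide:
  assumes "holomorphic2_at f z" "holomorphic2_at g z" "g z \<noteq> 0"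
  shows "holomorphic2_at (\<lambda>z. f z / g z) z"
proof -
  have "holomorphic2_at (\<lambda>z. inverse (g z)) z"
    using assms(2) DERIV_inverse[OF assms(3)] by (rule holomorphic2_at_compose)
  from holomorphic2_at_mult[OF assms(1) this] show ?thesis
    by (simp add: divide_inverse)
qed

lemma holomorphic2_at_sum:
  assumes "\<And>i. i \<in> I \<Longrightarrow> holomorphic2_at (f i) z"
  shows "holomorphic2_at (\<lambda>z. \<Sum>i\<in>I. f i z) z"
  using assms
  by (induction I rule: infinite_finite_induct) (auto intro: holomorphic2_at_const holomorphic2_at_add)

lemmas holomorphic2_at_intros = holomorphic2_at_const holomorphic2_at_fst holomorphic2_at_snd
  holomorphic2_at_add holomorphic2_at_diff holomorphic2_at_mult holomorphic2_at_divide
  holomorphic2_at_power holomorphic2_at_sum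

lemma Hk_denominators_nonzero:
  assumes "z \<in> Hk k" "w \<in> Hk k"
  shows "1 - snd z * cnj (snd w) \<noteq> 0" "snd z * cnj (snd w) - (fst z * cnj (fst w)) ^ k \<noteq> 0"
proof -
  show "1 - snd z * cnj (snd w) \<noteq> 0"
    using assms by (intro one_minus_mult_cnj_nonzero) (auto simp: Hk_def)
  have "cmod (fst z) ^ k * cmod (fst w) ^ k < cmod (snd z) * cmod (snd w)"
    using assms by (intro mult_strict_mono') (auto simp: Hk_def)
  then have "cmod ((fst z * cnj (fst w)) ^ k) < cmod (snd z * cnj (snd w))"
    by (simp add: norm_mult norm_power power_mult_distrib)
  then show "snd z * cnj (snd w) - (fst z * cnj (fst w)) ^ k \<noteq> 0"
    by auto
qed

lemma holomorphic2_on_PP: "w \<in> Hk k \<Longrightarrow> holomorphic2_on (\<lambda>z. PP k z w) (Hk k)"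
  unfolding holomorphic2_on_iff_at PP_def Let_def
  using Hk_denominators_nonzero by (intro ballI holomorphic2_at_intros) simp

lemma holomorphic2_on_BergK: "k \<ge> 1 \<Longrightarrow> w \<in> Hk k \<Longrightarrow> holomorphic2_on (\<lambda>z. BergK k z w) (Hk k)"
  unfolding holomorphic2_on_iff_at BergK_def pk_def qk_def Let_def
  using Hk_denominators_nonzero by (intro ballI holomorphic2_at_intros) simp

lemma holomorphic2_on_imp_continuous_on: "holomorphic2_on f U \<Longrightarrow> continuous_on U f"
  unfolding holomorphic2_on_def
  by (metis continuous_at_imp_continuous_on has_derivative_continuous)

text \<open>The chain rule with a complex-linear derivative; it makes the one-variable inequalities
  applicable to slices.\<close>

lemma holomorphic2_on_compose_curve:
  assumes f: "holomorphic2_on f U" and g: "g1 holomorphic_on S" "g2 holomorphic_on S" "open S"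
    and sub: "\<And>t. t \<in> S \<Longrightarrow> (g1 t, g2 t) \<in> U"
  shows "(\<lambda>t. f (g1 t, g2 t)) holomorphic_on S"
  unfolding holomorphic_on_open[OF \<open>open S\<close>]
proof safe
  fix t assume t: "t \<in> S"
  obtain d1 d2 where d: "(g1 has_field_derivative d1) (at t)" "(g2 has_field_derivative d2) (at t)"
    using g t by (meson holomorphic_on_open)
  obtain a b where ab: "(f has_derivative (\<lambda>h. a * fst h + b * snd h)) (at (g1 t, g2 t))"
    using f sub[OF t] unfolding holomorphic2_on_def by blast
  have "((\<lambda>t. (g1 t, g2 t)) has_derivative (\<lambda>h. (d1 * h, d2 * h))) (at t)"
    by (intro has_derivative_Pair d[unfolded has_field_derivative_def])
  from has_derivative_compose[OF this ab] have "((\<lambda>t. f (g1 t, g2 t)) has_field_derivative (a * d1 + b * d2)) (at t)"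
    unfolding has_field_derivative_def by (rule has_derivative_eq_rhs) (simp add: fun_eq_iff algebra_simps)
  then show "\<exists>f'. ((\<lambda>t. f (g1 t, g2 t)) has_field_derivative f') (at t)" ..
qed

text \<open>The one-variable inequalities are iterated for
  \<open>g s w = w ^ k * h (s * w, w ^ k)\<close>. The factor \<open>w ^ k\<close> is the Jacobian
  up to \<open>k\<close>, so the integral is controlled by the norm of \<open>h\<close>
  downstairs.\<close>

lemma submean_cover:
  assumes k: "k \<ge> 1" and h: "holomorphic2_on h (Hk k)" and a: "a \<in> cover_dom" and c: "0 < c" "c \<le> 1"
  shows "ennreal ((cmod (h (cover_map k a)))\<^sup>2) \<le> ennreal (local_weight k a / (pi\<^sup>2 * c ^ 4))
    * (\<integral>\<^sup>+ b\<in>{b \<in> cover_dom. near c a b}. ennreal (cmod (snd b) ^ (2 * k) * (cmod (h (cover_map k b)))\<^sup>2) \<partial>lborel)"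
proof -
  define g where "g s w = w ^ k * h (s * w, w ^ k)" for s w
  define r where "r = c * (1 - cmod (fst a))"
  define q where "q = c * (1 - cmod (snd a))"
  note pa = cover_dom_pos[OF a k]
  have rq: "r > 0" "q > 0"
    using c pa by (auto simp: r_def q_def)
  \<comment> \<open>\<open>c \<le> 1\<close> keeps the ball inside the unit disc, but it may well
    contain \<open>0\<close>.\<close>
  have sub: "ball u (c * (1 - cmod u)) \<subseteq> ball 0 1" if "cmod u < 1" for u :: complex
  proof
    fix v assume "v \<in> ball u (c * (1 - cmod u))"
    moreover have "c * (1 - cmod u) \<le> 1 * (1 - cmod u)"
      using c that by (intro mult_right_mono) auto
    moreover have "cmod v \<le> cmod u + dist u v"
      using norm_triangle_ineq2[of v u] by (simp add: dist_norm norm_minus_commute)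
    ultimately show "v \<in> ball 0 1" by simp
  qed
  have subr: "ball (fst a) r \<subseteq> ball 0 1" and subq: "ball (snd a) q \<subseteq> ball 0 1"
    unfolding r_def q_def using pa by (auto intro!: sub)
  have set_eq: "{b \<in> cover_dom. near c a b} = ball (fst a) r \<times> (ball (snd a) q - {0})"
    using subr subq by (auto simp: cover_dom_def near_def r_def q_def)
  have in_Hk: "(s * w, w ^ k) \<in> Hk k" if "cmod s < 1" "cmod w < 1" "w \<noteq> 0" for s w
    using cover_map_in_Hk[OF k, of "(s, w)"] that by (simp add: cover_map_def cover_dom_def)
  have hol1: "(\<lambda>s. g s w) holomorphic_on ball (fst a) r" if "w \<in> ball (snd a) q - {0}" for w
    unfolding g_def using that subr subq
    by (intro holomorphic_intros holomorphic2_on_compose_curve[OF h]) (auto intro!: in_Hk)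
  have hol2: "g (fst a) holomorphic_on ball (snd a) q - {0}"
    unfolding g_def using subr subq pa
    by (intro holomorphic_intros holomorphic2_on_compose_curve[OF h]) (auto intro!: in_Hk open_delete)
  let ?I = "\<integral>\<^sup>+ b\<in>{b \<in> cover_dom. near c a b}. ennreal (cmod (snd b) ^ (2 * k) * (cmod (h (cover_map k b)))\<^sup>2) \<partial>lborel"
  have int_eq: "?I = (\<integral>\<^sup>+ w. (\<integral>\<^sup>+ s. ennreal ((cmod (g s w))\<^sup>2) * indicator (ball (fst a) r) s \<partial>lborel) * indicator (ball (snd a) q - {0}) w \<partial>lborel)"
  proof -
    let ?B = "ball (fst a) r \<times> (ball (snd a) q - {0})"
    have oB: "open ?B"
      by (intro open_Times open_delete) auto
    have "(\<lambda>b. h (cover_map k b)) = h \<circ> cover_map k" by (simp add: o_def)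
    moreover have "continuous_on ?B (h \<circ> cover_map k)"
    proof (rule continuous_on_compose)
      show "continuous_on ?B (cover_map k)"
        unfolding cover_map_def by (intro continuous_intros)
      show "continuous_on (cover_map k ` ?B) h"
        by (rule continuous_on_subset[OF holomorphic2_on_imp_continuous_on[OF h]])
           (use cover_map_in_Hk[OF k] in \<open>auto simp flip: set_eq\<close>)
    qed
    ultimately have "continuous_on ?B (\<lambda>b. snd b ^ k * h (cover_map k b))"
      by (intro continuous_intros) auto
    then have m: "(\<lambda>b. ennreal ((cmod (snd b ^ k * h (cover_map k b)))\<^sup>2) * indicator ?B b) \<in> borel_measurable borel"
      by (rule borel_measurable_norm_square_indicator[OF oB])
    have "?I = (\<integral>\<^sup>+ b. ennreal ((cmod (snd b ^ k * h (cover_map k b)))\<^sup>2) * indicator ?B b \<partial>lborel)"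
      unfolding set_eq by (simp add: norm_mult norm_power power_mult_distrib mult.commute[of 2 k] flip: power_mult)
    also have "\<dots> = (\<integral>\<^sup>+ w. (\<integral>\<^sup>+ s. ennreal ((cmod (g s w))\<^sup>2) * indicator (ball (fst a) r) s * indicator (ball (snd a) q - {0}) w \<partial>lborel) \<partial>lborel)"
      unfolding nn_integral_complex_pair[OF m]
      by (intro nn_integral_cong) (auto simp: g_def cover_map_def indicator_def)
    also have "\<dots> = (\<integral>\<^sup>+ w. (\<integral>\<^sup>+ s. ennreal ((cmod (g s w))\<^sup>2) * indicator (ball (fst a) r) s \<partial>lborel) * indicator (ball (snd a) q - {0}) w \<partial>lborel)"
      by (intro nn_integral_cong) (simp add: indicator_def)
    finally show ?thesis .
  qed
  \<comment> \<open>The punctured inequality in \<open>w\<close>, with the first coordinate frozen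
    at \<open>fst a\<close>; the plain inequality in \<open>s\<close> follows for each
    \<open>w \<noteq> 0\<close>.\<close>
  have "ennreal (pi * r\<^sup>2) * ennreal (pi * q\<^sup>2 * (cmod (g (fst a) (snd a)))\<^sup>2)
      \<le> ennreal (pi * r\<^sup>2) * (\<integral>\<^sup>+ w\<in>ball (snd a) q - {0}. ennreal ((cmod (g (fst a) w))\<^sup>2) \<partial>lborel)"
    using pa rq by (intro mult_left_mono submean_square_punctured_ball[OF hol2]) auto
  also have "\<dots> = (\<integral>\<^sup>+ w. ennreal (pi * r\<^sup>2) * (ennreal ((cmod (g (fst a) w))\<^sup>2) * indicator (ball (snd a) q - {0}) w) \<partial>lborel)"
    using borel_measurable_norm_square_indicator[OF _ holomorphic_on_imp_continuous_on[OF hol2]]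
    by (intro nn_integral_cmult[symmetric]) (auto intro: open_delete)
  also have "\<dots> \<le> ?I"
    unfolding int_eq
  proof (rule nn_integral_mono)
    fix w
    show "ennreal (pi * r\<^sup>2) * (ennreal ((cmod (g (fst a) w))\<^sup>2) * indicator (ball (snd a) q - {0}) w)
        \<le> (\<integral>\<^sup>+ s. ennreal ((cmod (g s w))\<^sup>2) * indicator (ball (fst a) r) s \<partial>lborel) * indicator (ball (snd a) q - {0}) w"
    proof (cases "w \<in> ball (snd a) q - {0}")
      case True
      then show ?thesis
        using submean_square_ball[OF hol1[OF True] \<open>r > 0\<close>] by (simp add: ennreal_mult')
    qed simp
  qed
  finally have main: "ennreal (pi * r\<^sup>2) * ennreal (pi * q\<^sup>2 * (cmod (g (fst a) (snd a)))\<^sup>2) \<le> ?I" .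
  have "(cmod (h (cover_map k a)))\<^sup>2
      = local_weight k a / (pi\<^sup>2 * c ^ 4) * (pi * r\<^sup>2 * (pi * q\<^sup>2 * (cmod (g (fst a) (snd a)))\<^sup>2))"
  proof -
    have eq: "(cmod (g (fst a) (snd a)))\<^sup>2 = cmod (snd a) ^ (2 * k) * (cmod (h (cover_map k a)))\<^sup>2"
      by (simp add: g_def cover_map_def norm_mult norm_power power_mult_distrib mult.commute[of 2 k] flip: power_mult)
    have cancel: "L = 1 / (W * X\<^sup>2 * Y\<^sup>2) / (P\<^sup>2 * c ^ 4) * (P * (c * X)\<^sup>2 * (P * (c * Y)\<^sup>2 * (W * L)))"
      if "W > 0" "X > 0" "Y > 0" "P > 0" for L W X Y P :: real
      using that c by (simp add: power2_eq_square power4_eq_xxxx)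
    show ?thesis
      unfolding eq local_weight_def r_def q_def by (rule cancel) (use pa in auto)
  qed
  then have "ennreal ((cmod (h (cover_map k a)))\<^sup>2)
      = ennreal (local_weight k a / (pi\<^sup>2 * c ^ 4)) * (ennreal (pi * r\<^sup>2) * ennreal (pi * q\<^sup>2 * (cmod (g (fst a) (snd a)))\<^sup>2))"
    by (simp only:) (subst ennreal_mult; (subst ennreal_mult)?; simp add: local_weight_def)
  also have "\<dots> \<le> ennreal (local_weight k a / (pi\<^sup>2 * c ^ 4)) * ?I"
    by (intro mult_left_mono main) auto
  finally show ?thesis .
qed

section \<open>Carleson measures and kernel transforms\<close>

lemma BergK_diag_pos:
  assumes k: "k \<ge> 1" and b: "b \<in> cover_dom"
  shows "Re (BergK k (cover_map k b) (cover_map k b)) > 0"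
proof (rule less_le_trans)
  show "0 < kernel_diag k b / (real k * pi\<^sup>2)"
    using kernel_diag_pos[OF b k] k by simp
qed (rule BergK_diag_bounds[OF b k])

text \<open>Collects what the equivalence demands of a kernel, so that one argument serves
  \<open>PP\<close> and \<open>BergK\<close>. \<open>norm_le\<close> bounds the norm of the
  normalised kernel functions and gives boundedness of the transform from the Carleson property;
  \<open>lower\<close> replaces the sub-mean value weight by the kernel and gives the
  converse.\<close>

locale test_kernel =
  fixes k :: nat and \<Phi> :: "complex \<times> complex \<Rightarrow> complex \<times> complex \<Rightarrow> complex" and A B c :: real
  assumes k: "k \<ge> 1"
    and kernel_measurable: "(\<lambda>p. \<Phi> (fst p) (snd p)) \<in> borel_measurable borel"
    and holomorphic: "w \<in> Hk k \<Longrightarrow> holomorphic2_on (\<lambda>z. \<Phi> z w) (Hk k)"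
    and A: "A \<ge> 0" and B: "B \<ge> 0" and c: "c > 0" "c \<le> 1/2"
    and norm_le: "b \<in> cover_dom \<Longrightarrow> (\<integral>\<^sup>+ z\<in>Hk k. ennreal ((cmod (\<Phi> z (cover_map k b)))\<^sup>2) \<partial>lborel)
      \<le> ennreal (A * Re (BergK k (cover_map k b) (cover_map k b)))"
    and lower: "a \<in> cover_dom \<Longrightarrow> b \<in> cover_dom \<Longrightarrow> near c a b \<Longrightarrow> local_weight k a
      \<le> B * ((cmod (\<Phi> (cover_map k a) (cover_map k b)))\<^sup>2 / Re (BergK k (cover_map k b) (cover_map k b)))"
begin

definition quot :: "complex \<times> complex \<Rightarrow> complex \<times> complex \<Rightarrow> real" where
  "quot z w = (cmod (\<Phi> z w))\<^sup>2 / Re (BergK k w w)"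

definition transform :: "(complex \<times> complex) measure \<Rightarrow> complex \<times> complex \<Rightarrow> ennreal" where
  "transform \<mu> w = (\<integral>\<^sup>+ z\<in>Hk k. ennreal (quot z w) \<partial>\<mu>)"

lemma borel_measurable_pair_complex:
  "(\<lambda>x. (f x, g x)) \<in> borel_measurable M" if "f \<in> borel_measurable M" "g \<in> borel_measurable M"
  for f g :: "'b \<Rightarrow> complex \<times> complex"
  using measurable_Pair[OF that] by (simp add: borel_prod)

lemma quot_measurable [measurable]:
  assumes f[measurable]: "f \<in> borel_measurable M" and g[measurable]: "g \<in> borel_measurable M"
  shows "(\<lambda>x. quot (f x) (g x)) \<in> borel_measurable M"
proof -
  have [measurable]: "(\<lambda>x. \<Phi> (f x) (g x)) \<in> borel_measurable M"
    using measurable_compose[OF borel_measurable_pair_complex[OF f g] kernel_measurable] by simp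
  show ?thesis
    unfolding quot_def by measurable
qed

lemma quot_nonneg: "w \<in> Hk k \<Longrightarrow> quot z w \<ge> 0"
  using BergK_diag_pos[OF k cover_lift_in_dom[OF k]] cover_map_lift[OF k]
  by (simp add: quot_def less_imp_le)

context
  fixes \<mu> :: "(complex \<times> complex) measure"
  assumes sets: "sets \<mu> = sets borel" and fin: "finite_measure \<mu>"
begin

text \<open>Joint measurability of the kernel and finiteness of \<open>\<mu>\<close> make the
  parametrised integral Borel in \<open>w\<close>, as \<open>Linf_on\<close> demands.\<close>

lemma transform_measurable [measurable]: "transform \<mu> \<in> borel_measurable borel"
proof -
  interpret finite_measure \<mu> by (rule fin)
  note [measurable_cong] = sets
  have [measurable]: "(\<lambda>z. z) \<in> borel_measurable \<mu>"
    by (simp add: measurable_cong_sets[OF sets refl] measurable_ident)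
  show ?thesis
    unfolding transform_def[abs_def] by measurable
qed

text \<open>The Carleson inequality is tested on \<open>\<Phi> z w\<close> as a function of
  \<open>z\<close>; dividing by the diagonal value leaves the bound \<open>C * A\<close> at every
  point \<open>w\<close>.\<close>

lemma transform_bounded_if_carleson:
  assumes "carleson k \<mu>"
  shows "\<exists>M. \<forall>w\<in>Hk k. transform \<mu> w \<le> ennreal M"
proof -
  note [measurable_cong] = sets
  obtain C where C: "C > 0" "\<And>h. h \<in> A2 k \<Longrightarrow> (\<integral>\<^sup>+ z\<in>Hk k. ennreal ((cmod (h z))\<^sup>2) \<partial>\<mu>)
       \<le> ennreal C * (\<integral>\<^sup>+ z\<in>Hk k. ennreal ((cmod (h z))\<^sup>2) \<partial>lborel)"
    using assms unfolding carleson_def by blast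
  have "transform \<mu> w \<le> ennreal (C * A)" if w: "w \<in> Hk k" for w
  proof -
    obtain b where b: "b \<in> cover_dom" "w = cover_map k b"
      using cover_map_lift[OF k w] cover_lift_in_dom[OF k w] by metis
    let ?R = "Re (BergK k w w)"
    have R: "?R > 0"
      unfolding b by (rule BergK_diag_pos[OF k b(1)])
    have norm: "(\<integral>\<^sup>+ z\<in>Hk k. ennreal ((cmod (\<Phi> z w))\<^sup>2) \<partial>lborel) \<le> ennreal (A * ?R)"
      unfolding b by (rule norm_le[OF b(1)])
    then have "(\<lambda>z. \<Phi> z w) \<in> A2 k"
      using holomorphic[OF w] by (auto simp: A2_def intro: le_less_trans)
    have [measurable]: "(\<lambda>z. \<Phi> z w) \<in> borel_measurable borel"
      using measurable_compose[OF borel_measurable_pair_complex[OF measurable_ident measurable_const] kernel_measurable]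
      by simp
    have "transform \<mu> w = (\<integral>\<^sup>+ z. ennreal (1 / ?R) * (ennreal ((cmod (\<Phi> z w))\<^sup>2) * indicator (Hk k) z) \<partial>\<mu>)"
      unfolding transform_def quot_def using R
      by (intro nn_integral_cong) (simp add: indicator_def flip: ennreal_mult')
    also have "\<dots> = ennreal (1 / ?R) * (\<integral>\<^sup>+ z\<in>Hk k. ennreal ((cmod (\<Phi> z w))\<^sup>2) \<partial>\<mu>)"
      by (rule nn_integral_cmult) measurable
    also have "\<dots> \<le> ennreal (1 / ?R) * (ennreal C * ennreal (A * ?R))"
      by (intro mult_left_mono order_trans[OF C(2)[OF \<open>(\<lambda>z. \<Phi> z w) \<in> A2 k\<close>]] norm) auto
    also have "\<dots> = ennreal (C * A)"
      using R C(1) A by (simp flip: ennreal_mult')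
    finally show ?thesis .
  qed
  then show ?thesis by blast
qed

text \<open>After Tonelli the transform stands under a Lebesgue integral, so an almost everywhere
  bound suffices. That bound lives on \<open>Hk k\<close>, hence the integral is pushed down through
  the covering before it is used.\<close>

lemma carleson_if_transform_bounded:
  assumes bounded: "AE w in lborel. w \<in> Hk k \<longrightarrow> transform \<mu> w \<le> ennreal M"
  shows "carleson k \<mu>"
proof -
  interpret \<mu>: finite_measure \<mu> by (rule fin)
  interpret pair: pair_sigma_finite \<mu> "lborel :: (complex \<times> complex) measure" ..
  note [measurable_cong] = sets
  have [measurable]: "(\<lambda>z. z) \<in> borel_measurable \<mu>"
    by (simp add: measurable_cong_sets[OF sets refl] measurable_ident)
  define D where "D = B / (pi\<^sup>2 * c ^ 4)"
  have D: "D \<ge> 0"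
    using B c by (simp add: D_def)
  \<comment> \<open>The summand \<open>1\<close> makes \<open>C\<close> positive in degenerate
    cases; \<open>M\<close> itself may be negative.\<close>
  define C where "C = D * real k * \<bar>M\<bar> + 1"
  have "C > 0"
    using D by (simp add: C_def add_nonneg_pos)
  show ?thesis
    unfolding carleson_def
  proof (intro exI[of _ C] conjI ballI \<open>C > 0\<close>)
    fix h assume "h \<in> A2 k"
    then have h: "holomorphic2_on h (Hk k)"
      by (simp add: A2_def)
    define H where "H z = ennreal ((cmod (h z))\<^sup>2) * indicator (Hk k) z" for z
    have H[measurable]: "H \<in> borel_measurable borel"
      unfolding H_def by (intro borel_measurable_norm_square_indicator open_Hk holomorphic2_on_imp_continuous_on h)
    \<comment> \<open>The part of the integrand that does not depend on \<open>z\<close>, to be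
      taken out of the integral over \<open>\<mu>\<close>.\<close>
    define W where "W b = ennreal (D * cmod (snd b) ^ (2 * k)) * indicator cover_dom b * H (cover_map k b)"
      for b :: "complex \<times> complex"
    have [measurable]: "W \<in> borel_measurable borel"
      unfolding W_def by measurable
    have pointwise: "H z \<le> (\<integral>\<^sup>+ b. W b * (ennreal (quot z (cover_map k b)) * indicator (Hk k) z) \<partial>lborel)" for z
    proof (cases "z \<in> Hk k")
      case True
      define a where "a = cover_lift k z"
      have a: "a \<in> cover_dom" "cover_map k a = z"
        unfolding a_def using cover_lift_in_dom[OF k True] cover_map_lift[OF k True] by auto
      define N where "N = {b \<in> cover_dom. near c a b}"
      let ?h = "\<lambda>b. cmod (snd b) ^ (2 * k) * (cmod (h (cover_map k b)))\<^sup>2"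
      let ?C = "local_weight k a / (pi\<^sup>2 * c ^ 4)"
      have "{b. near c a b} = ball (fst a) (c * (1 - cmod (fst a))) \<times> ball (snd a) (c * (1 - cmod (snd a)))"
        by (auto simp: near_def)
      then have "open {b. near c a b}"
        by (simp add: open_Times)
      then have "open (cover_dom \<inter> {b. near c a b})"
        by (rule open_Int[OF open_cover_dom])
      moreover have "N = cover_dom \<inter> {b. near c a b}"
        by (auto simp: N_def)
      ultimately have [measurable]: "N \<in> sets borel"
        by (simp only: borel_open)
      \<comment> \<open>Measurability passes through \<open>H\<close>, the extension by zero,
        because \<open>h\<close> is uncontrolled off \<open>Hk k\<close>.\<close>
      have "(\<lambda>b. ennreal (cmod (snd b) ^ (2 * k)) * H (cover_map k b) * indicator N b) \<in> borel_measurable lborel"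
        by measurable
      also have "(\<lambda>b. ennreal (cmod (snd b) ^ (2 * k)) * H (cover_map k b) * indicator N b)
          = (\<lambda>b. ennreal (?h b) * indicator N b)"
      proof (rule ext)
        fix b
        show "ennreal (cmod (snd b) ^ (2 * k)) * H (cover_map k b) * indicator N b = ennreal (?h b) * indicator N b"
        proof (cases "b \<in> N")
          case True
          then have "cover_map k b \<in> Hk k"
            using cover_map_in_Hk[OF k] by (auto simp: N_def)
          then show ?thesis
            by (simp add: H_def ennreal_mult)
        qed simp
      qed
      finally have meas: "(\<lambda>b. ennreal (?h b) * indicator N b) \<in> borel_measurable lborel" .
      have "c \<le> 1"
        using c by simp
      have "H z = ennreal ((cmod (h z))\<^sup>2)"
        using True by (simp add: H_def)
      also have "\<dots> \<le> ennreal ?C * (\<integral>\<^sup>+ b\<in>N. ennreal (?h b) \<partial>lborel)"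
        using submean_cover[OF k h a(1) c(1) \<open>c \<le> 1\<close>] unfolding a(2) N_def[symmetric] .
      also have "\<dots> = (\<integral>\<^sup>+ b. ennreal ?C * (ennreal (?h b) * indicator N b) \<partial>lborel)"
        by (rule nn_integral_cmult[OF meas, symmetric])
      also have "\<dots> \<le> (\<integral>\<^sup>+ b. W b * (ennreal (quot z (cover_map k b)) * indicator (Hk k) z) \<partial>lborel)"
      proof (rule nn_integral_mono)
        fix b
        show "ennreal ?C * (ennreal (?h b) * indicator N b) \<le> W b * (ennreal (quot z (cover_map k b)) * indicator (Hk k) z)"
        proof (cases "b \<in> N")
          case N: True
          then have b: "b \<in> cover_dom" "cover_map k b \<in> Hk k" "near c a b"
            using cover_map_in_Hk[OF k] by (auto simp: N_def)
          have "local_weight k a \<le> B * quot z (cover_map k b)"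
            using lower[OF a(1) b(1,3)] by (simp add: a(2) quot_def)
          then have "?C \<le> B * quot z (cover_map k b) / (pi\<^sup>2 * c ^ 4)"
            using c by (intro divide_right_mono) auto
          then have "?C \<le> D * quot z (cover_map k b)"
            by (simp add: D_def)
          then have "?C * ?h b \<le> D * quot z (cover_map k b) * ?h b"
            by (intro mult_right_mono) auto
          then have "ennreal (?C * ?h b) \<le> ennreal (D * cmod (snd b) ^ (2 * k) * ((cmod (h (cover_map k b)))\<^sup>2 * quot z (cover_map k b)))"
            by (intro ennreal_leI) (simp add: mult_ac)
          also have "\<dots> = ennreal (D * cmod (snd b) ^ (2 * k)) * (ennreal ((cmod (h (cover_map k b)))\<^sup>2) * ennreal (quot z (cover_map k b)))"
            using D quot_nonneg[OF b(2)] by (simp add: ennreal_mult)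
          also have "ennreal (?C * ?h b) = ennreal ?C * ennreal (?h b)"
            by (intro ennreal_mult'') auto
          finally show ?thesis
            using N b True by (simp add: W_def H_def mult_ac)
        qed simp
      qed
      finally show ?thesis .
    qed (simp add: H_def)
    have HT: "(\<lambda>z. H z * transform \<mu> z) \<in> borel_measurable borel"
      by measurable
    have HM: "(\<integral>\<^sup>+ z. ennreal \<bar>M\<bar> * H z \<partial>lborel) = ennreal \<bar>M\<bar> * (\<integral>\<^sup>+ z. H z \<partial>lborel)"
      by (rule nn_integral_cmult) measurable
    have HTD: "(\<lambda>b. (H (cover_map k b) * transform \<mu> (cover_map k b))
        * ennreal ((real k)\<^sup>2 * cmod (snd b) ^ (2 * k)) * indicator cover_dom b) \<in> borel_measurable lborel"
      by measurable
    have "(\<integral>\<^sup>+ z\<in>Hk k. ennreal ((cmod (h z))\<^sup>2) \<partial>\<mu>) = (\<integral>\<^sup>+ z. H z \<partial>\<mu>)"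
      by (simp add: H_def)
    also have "\<dots> \<le> (\<integral>\<^sup>+ z. (\<integral>\<^sup>+ b. W b * (ennreal (quot z (cover_map k b)) * indicator (Hk k) z) \<partial>lborel) \<partial>\<mu>)"
      by (intro nn_integral_mono pointwise)
    also have "\<dots> = (\<integral>\<^sup>+ b. (\<integral>\<^sup>+ z. W b * (ennreal (quot z (cover_map k b)) * indicator (Hk k) z) \<partial>\<mu>) \<partial>lborel)"
      by (rule pair.Fubini'[symmetric]) measurable
    also have "\<dots> = (\<integral>\<^sup>+ b. W b * transform \<mu> (cover_map k b) \<partial>lborel)"
      unfolding transform_def by (intro nn_integral_cong nn_integral_cmult) measurable
    also have "\<dots> \<le> (\<integral>\<^sup>+ b. ennreal D * ((H (cover_map k b) * transform \<mu> (cover_map k b))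
        * ennreal ((real k)\<^sup>2 * cmod (snd b) ^ (2 * k)) * indicator cover_dom b) \<partial>lborel)"
    proof (rule nn_integral_mono)
      fix b :: "complex \<times> complex"
      \<comment> \<open>The factor \<open>k^2 \<ge> 1\<close> completes the Jacobian.\<close>
      have "1 * cmod (snd b) ^ (2 * k) \<le> (real k)\<^sup>2 * cmod (snd b) ^ (2 * k)"
        using k by (intro mult_right_mono) (auto simp: one_le_power)
      then have "ennreal D * ennreal (cmod (snd b) ^ (2 * k)) \<le> ennreal D * ennreal ((real k)\<^sup>2 * cmod (snd b) ^ (2 * k))"
        by (intro mult_left_mono ennreal_leI) auto
      then have "ennreal (D * cmod (snd b) ^ (2 * k)) \<le> ennreal D * ennreal ((real k)\<^sup>2 * cmod (snd b) ^ (2 * k))"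
        using D by (simp add: ennreal_mult)
      then have "ennreal (D * cmod (snd b) ^ (2 * k)) * (indicator cover_dom b * H (cover_map k b) * transform \<mu> (cover_map k b))
          \<le> ennreal D * ennreal ((real k)\<^sup>2 * cmod (snd b) ^ (2 * k)) * (indicator cover_dom b * H (cover_map k b) * transform \<mu> (cover_map k b))"
        by (rule mult_right_mono) simp
      then show "W b * transform \<mu> (cover_map k b) \<le> ennreal D * ((H (cover_map k b) * transform \<mu> (cover_map k b))
        * ennreal ((real k)\<^sup>2 * cmod (snd b) ^ (2 * k)) * indicator cover_dom b)"
        unfolding W_def by (simp only: mult_ac)
    qed
    also have "\<dots> = ennreal D * (\<integral>\<^sup>+ b\<in>cover_dom. (H (cover_map k b) * transform \<mu> (cover_map k b))
        * ennreal ((real k)\<^sup>2 * cmod (snd b) ^ (2 * k)) \<partial>lborel)"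
      by (rule nn_integral_cmult[OF HTD])
    also have "\<dots> \<le> ennreal D * (of_nat k * (\<integral>\<^sup>+ z\<in>Hk k. H z * transform \<mu> z \<partial>lborel))"
      by (rule mult_left_mono[OF nn_integral_cover_le_Hk[OF k HT]]) simp
    also have "\<dots> \<le> ennreal D * (of_nat k * (\<integral>\<^sup>+ z. ennreal \<bar>M\<bar> * H z \<partial>lborel))"
    proof (intro mult_left_mono nn_integral_mono_AE)
      show "AE z in lborel. H z * transform \<mu> z * indicator (Hk k) z \<le> ennreal \<bar>M\<bar> * H z"
        using bounded
      proof eventually_elim
        case (elim z)
        show ?case
        proof (cases "z \<in> Hk k")
          case True
          then have "transform \<mu> z \<le> ennreal \<bar>M\<bar>"
            using elim by (auto intro: order_trans ennreal_leI)
          then have "H z * transform \<mu> z \<le> H z * ennreal \<bar>M\<bar>"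
            by (rule mult_left_mono) simp
          then show ?thesis
            using True by (simp add: mult.commute)
        qed simp
      qed
    qed auto
    also have "\<dots> = ennreal (D * real k * \<bar>M\<bar>) * (\<integral>\<^sup>+ z. H z \<partial>lborel)"
      using D unfolding HM by (simp add: ennreal_mult ennreal_of_nat_eq_real_of_nat mult_ac)
    also have "\<dots> \<le> ennreal C * (\<integral>\<^sup>+ z. H z \<partial>lborel)"
      by (intro mult_right_mono ennreal_leI) (auto simp: C_def)
    also have "\<dots> = ennreal C * (\<integral>\<^sup>+ z\<in>Hk k. ennreal ((cmod (h z))\<^sup>2) \<partial>lborel)"
      by (simp add: H_def)
    finally show "(\<integral>\<^sup>+ z\<in>Hk k. ennreal ((cmod (h z))\<^sup>2) \<partial>\<mu>)
       \<le> ennreal C * (\<integral>\<^sup>+ z\<in>Hk k. ennreal ((cmod (h z))\<^sup>2) \<partial>lborel)" .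
  qed
qed

lemma carleson_iff_Linf_on: "carleson k \<mu> \<longleftrightarrow> Linf_on (Hk k) (transform \<mu>)"
proof
  assume "carleson k \<mu>"
  then obtain M where "\<forall>w\<in>Hk k. transform \<mu> w \<le> ennreal M"
    using transform_bounded_if_carleson by blast
  then show "Linf_on (Hk k) (transform \<mu>)"
    unfolding Linf_on_def by (auto intro!: measurable_restrict_space1 exI[of _ M])
next
  assume "Linf_on (Hk k) (transform \<mu>)"
  then show "carleson k \<mu>"
    unfolding Linf_on_def using carleson_if_transform_bounded by blast
qed

end

end

section \<open>The two kernels as instances\<close>

text \<open>\<open>A\<close> and \<open>B\<close> are chosen before \<open>c\<close>, so
  \<open>c\<close> remains free to be shrunk for \<open>BergK\<close>. Both combine the estimates
  for \<open>PP\<close> with the comparison of the diagonal values.\<close>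

lemma test_kernel_PP:
  assumes k: "k \<ge> 1"
  shows "\<exists>A B. \<forall>c. 0 < c \<longrightarrow> c \<le> 1/2 \<longrightarrow> test_kernel k (PP k) A B c"
proof -
  define A where "A = (20 * pi * (real k)\<^sup>2)\<^sup>2 * (real k * pi\<^sup>2)"
  define B where "B = (4 * (3 * real k) ^ 4)\<^sup>2 * ((real k)\<^sup>2 / pi\<^sup>2)"
  have "test_kernel k (PP k) A B c" if c: "0 < c" "c \<le> 1/2" for c
  proof
    show "(\<lambda>p. PP k (fst p) (snd p)) \<in> borel_measurable borel"
      by (rule borel_measurable_PP) (intro borel_measurable_continuous_onI continuous_intros)+
    show "holomorphic2_on (\<lambda>z. PP k z w) (Hk k)" if "w \<in> Hk k" for w
      using that by (rule holomorphic2_on_PP)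
    fix b assume b: "b \<in> cover_dom"
    let ?w = "cover_map k b"
    have diag: "kernel_diag k b \<le> real k * pi\<^sup>2 * Re (BergK k ?w ?w)"
      using BergK_diag_bounds(1)[OF b k] k by (simp add: pos_divide_le_eq mult_ac)
    have R: "Re (BergK k ?w ?w) > 0"
      by (rule BergK_diag_pos[OF k b])
    have "(\<integral>\<^sup>+ z\<in>Hk k. ennreal ((cmod (PP k z ?w))\<^sup>2) \<partial>lborel) \<le> ennreal ((20 * pi * (real k)\<^sup>2)\<^sup>2 * kernel_diag k b)"
      by (rule nn_integral_PP_le[OF k b])
    also have "\<dots> \<le> ennreal ((20 * pi * (real k)\<^sup>2)\<^sup>2 * (real k * pi\<^sup>2 * Re (BergK k ?w ?w)))"
      by (intro ennreal_leI mult_left_mono diag) auto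
    finally show "(\<integral>\<^sup>+ z\<in>Hk k. ennreal ((cmod (PP k z ?w))\<^sup>2) \<partial>lborel) \<le> ennreal (A * Re (BergK k ?w ?w))"
      by (simp only: A_def mult.assoc)
    fix a assume a: "a \<in> cover_dom" and near: "near c a b"
    let ?P = "(cmod (PP k (cover_map k a) ?w))\<^sup>2"
    have "1 / x \<le> C / y" if "x > 0" "y > 0" "y \<le> C * x" for x y C :: real
      using that by (simp add: field_simps)
    from this[OF kernel_diag_pos[OF b k] R BergK_diag_bounds(2)[OF b k]]
    have "1 / kernel_diag k b \<le> (real k)\<^sup>2 / pi\<^sup>2 / Re (BergK k ?w ?w)" .
    then have "?P * (1 / kernel_diag k b) \<le> ?P * ((real k)\<^sup>2 / pi\<^sup>2 / Re (BergK k ?w ?w))"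
      by (rule mult_left_mono) simp
    then have "?P / kernel_diag k b \<le> (real k)\<^sup>2 / pi\<^sup>2 * (?P / Re (BergK k ?w ?w))"
      by (simp add: mult.commute)
    then have "(4 * (3 * real k) ^ 4)\<^sup>2 * (?P / kernel_diag k b) \<le> B * (?P / Re (BergK k ?w ?w))"
      unfolding B_def mult.assoc by (rule mult_left_mono) (rule zero_le_power2)
    with PP_lower[OF k a b near c(2)] show "local_weight k a \<le> B * (?P / Re (BergK k ?w ?w))"
      by (rule order_trans)
  qed (use k c in \<open>auto simp: A_def B_def\<close>)
  then show ?thesis by blast
qed

text \<open>Inherited from \<open>PP\<close>: the upper bound of the numerator transfers the norm
  estimate, and its lower bound \<open>1/2\<close> near the diagonal, valid for the \<open>c\<close>
  of \<open>kernel_num_lower\<close>, transfers \<open>lower\<close>.\<close>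

lemma test_kernel_BergK:
  assumes k: "k \<ge> 1"
  shows "\<exists>A B c. test_kernel k (BergK k) A B c"
proof -
  obtain c where c: "c > 0" "c \<le> 1/2" and num: "\<And>a b. a \<in> cover_dom \<Longrightarrow> b \<in> cover_dom \<Longrightarrow> near c a b \<Longrightarrow>
      1/2 \<le> cmod (kernel_num k (fst a * cnj (fst b)) (snd a * cnj (snd b)))"
    using kernel_num_lower[OF k] by blast
  obtain A B where "test_kernel k (PP k) A B c"
    using test_kernel_PP[OF k] c by blast
  then interpret P: test_kernel k "PP k" A B c .
  define A' where "A' = ((real k)\<^sup>2 / pi\<^sup>2)\<^sup>2 * A"
  \<comment> \<open>Near the diagonal \<open>|PP| \<le> 2 * k * pi^2 * |BergK|\<close>, the
    \<open>2\<close> undoing the bound \<open>1/2\<close>.\<close>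
  define B' where "B' = B * (2 * (real k * pi\<^sup>2))\<^sup>2"
  have "test_kernel k (BergK k) A' B' c"
  proof
    show "(\<lambda>p. BergK k (fst p) (snd p)) \<in> borel_measurable borel"
      by (rule borel_measurable_BergK) (intro borel_measurable_continuous_onI continuous_intros)+
    show "holomorphic2_on (\<lambda>z. BergK k z w) (Hk k)" if "w \<in> Hk k" for w
      using k that by (rule holomorphic2_on_BergK)
    fix b assume b: "b \<in> cover_dom"
    let ?w = "cover_map k b" and ?D = "((real k)\<^sup>2 / pi\<^sup>2)\<^sup>2"
    have [measurable]: "(\<lambda>z. PP k z ?w) \<in> borel_measurable borel"
      by measurable
    have "(\<integral>\<^sup>+ z\<in>Hk k. ennreal ((cmod (BergK k z ?w))\<^sup>2) \<partial>lborel)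
        \<le> (\<integral>\<^sup>+ z. ennreal ?D * (ennreal ((cmod (PP k z ?w))\<^sup>2) * indicator (Hk k) z) \<partial>lborel)"
    proof (rule nn_integral_mono)
      fix z
      show "ennreal ((cmod (BergK k z ?w))\<^sup>2) * indicator (Hk k) z
          \<le> ennreal ?D * (ennreal ((cmod (PP k z ?w))\<^sup>2) * indicator (Hk k) z)"
      proof (cases "z \<in> Hk k")
        case True
        have "cmod (BergK k z ?w) \<le> (real k)\<^sup>2 / pi\<^sup>2 * cmod (PP k z ?w)"
          using norm_BergK_le[OF k cover_lift_in_dom[OF k True] b] by (simp only: cover_map_lift[OF k True])
        then have "(cmod (BergK k z ?w))\<^sup>2 \<le> ((real k)\<^sup>2 / pi\<^sup>2 * cmod (PP k z ?w))\<^sup>2"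
          by (intro power_mono) auto
        then have "ennreal ((cmod (BergK k z ?w))\<^sup>2) \<le> ennreal (?D * (cmod (PP k z ?w))\<^sup>2)"
          by (intro ennreal_leI) (simp only: power_mult_distrib)
        also have "\<dots> = ennreal ?D * ennreal ((cmod (PP k z ?w))\<^sup>2)"
          by (rule ennreal_mult) auto
        finally show ?thesis
          using True by simp
      qed simp
    qed
    also have "\<dots> = ennreal ?D * (\<integral>\<^sup>+ z\<in>Hk k. ennreal ((cmod (PP k z ?w))\<^sup>2) \<partial>lborel)"
      by (rule nn_integral_cmult) measurable
    also have "\<dots> \<le> ennreal ?D * ennreal (A * Re (BergK k ?w ?w))"
      by (intro mult_left_mono P.norm_le b) auto
    also have "\<dots> = ennreal (?D * (A * Re (BergK k ?w ?w)))"
      by (rule ennreal_mult'[symmetric]) simp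
    finally show "(\<integral>\<^sup>+ z\<in>Hk k. ennreal ((cmod (BergK k z ?w))\<^sup>2) \<partial>lborel) \<le> ennreal (A' * Re (BergK k ?w ?w))"
      by (simp only: A'_def mult.assoc)
    fix a assume a: "a \<in> cover_dom" and near: "near c a b"
    let ?P = "PP k (cover_map k a) ?w" and ?K = "BergK k (cover_map k a) ?w"
    have nz: "snd a * cnj (snd b) \<noteq> 0"
      using a b by (auto simp: cover_dom_def)
    have "1/2 * cmod ?P \<le> cmod (kernel_num k (fst a * cnj (fst b)) (snd a * cnj (snd b))) * cmod ?P"
      by (intro mult_right_mono num a b near) auto
    also have "\<dots> = real k * pi\<^sup>2 * cmod ?K"
      unfolding BergK_cover_map[OF refl refl nz] using k by (simp add: norm_divide norm_mult norm_power)
    finally have "cmod ?P \<le> 2 * (real k * pi\<^sup>2) * cmod ?K"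
      by simp
    then have "(cmod ?P)\<^sup>2 \<le> (2 * (real k * pi\<^sup>2))\<^sup>2 * (cmod ?K)\<^sup>2"
      unfolding power_mult_distrib[of _ "cmod _", symmetric] by (intro power_mono) auto
    then have "B * ((cmod ?P)\<^sup>2 / Re (BergK k ?w ?w)) \<le> B * ((2 * (real k * pi\<^sup>2))\<^sup>2 * (cmod ?K)\<^sup>2 / Re (BergK k ?w ?w))"
      using P.B BergK_diag_pos[OF k b] by (intro mult_left_mono divide_right_mono) auto
    with P.lower[OF a b near] show "local_weight k a \<le> B' * ((cmod ?K)\<^sup>2 / Re (BergK k ?w ?w))"
      by (simp add: B'_def)
  qed (use k c P.A P.B in \<open>auto simp: A'_def B'_def\<close>)
  then show ?thesis by blast
qed

theorem theorem1p3:
  fixes k :: nat and \<mu> :: "(complex \<times> complex) measure"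
  assumes "k \<ge> 1"
    and "sets \<mu> = sets lborel"
    and "finite_measure \<mu>"
    and "emeasure \<mu> (- Hk k) = 0"
  shows "(carleson k \<mu> \<longleftrightarrow> Linf_on (Hk k) (B_mu k \<mu>))
       \<and> (Linf_on (Hk k) (B_mu k \<mu>) \<longleftrightarrow> Linf_on (Hk k) (T_mu k \<mu>))"
proof -
  have sets: "sets \<mu> = sets borel"
    using assms(2) by simp
  obtain A B where "\<forall>c. 0 < c \<longrightarrow> c \<le> 1/2 \<longrightarrow> test_kernel k (PP k) A B c"
    using test_kernel_PP[OF assms(1)] by blast
  from this[rule_format, of "1/2"] have T: "test_kernel k (PP k) A B (1/2)" by simp
  have "T_mu k \<mu> = test_kernel.transform k (PP k) \<mu>"
    by (intro ext) (simp only: T_mu_def test_kernel.transform_def[OF T] test_kernel.quot_def[OF T])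
  with test_kernel.carleson_iff_Linf_on[OF T sets assms(3)]
  have 1: "carleson k \<mu> \<longleftrightarrow> Linf_on (Hk k) (T_mu k \<mu>)" by simp
  obtain A B c where T: "test_kernel k (BergK k) A B c"
    using test_kernel_BergK[OF assms(1)] by blast
  have "B_mu k \<mu> = test_kernel.transform k (BergK k) \<mu>"
    by (intro ext) (simp only: B_mu_def test_kernel.transform_def[OF T] test_kernel.quot_def[OF T])
  with test_kernel.carleson_iff_Linf_on[OF T sets assms(3)]
  have 2: "carleson k \<mu> \<longleftrightarrow> Linf_on (Hk k) (B_mu k \<mu>)" by simp
  from 1 2 show ?thesis by simp
qed

end
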